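(* Let $(\mu_t)_{0\le t\le T}$ be a deterministic flow of probability measures such that $t\mapsto \mu_t\in\mathcal P_2(\mathbb R)$ is measurable and bounded, and suppose that the standing assumptions (i)–(iii) listed in the context hold. Let $\hat a(t,x,\mu,y)$ denote the minimizer of $a\mapsto H(t,x,\mu,y,a)$ over $a\in A$. Suppose that the forward-backward system $$ \begin{cases} dX_t=b\big(t,X_t,\mu_t,\hat a(t,X_t,\mu_t,Y_t)\big)\,dt+\sigma\,dW_t,\\ dY_t=-\dfrac{\partial H}{\partial x}\big(t,X_t,\mu_t,Y_t,\hat a(t,X_t,\mu_t,Y_t)\big)\,dt+Z_t\,dW_t,\\ X_0=x_0,\qquad Y_T=\dfrac{\partial g}{\partial x}(X_T,\mu_T), \end{cases} $$ has an adapted solution $(X_t,Y_t,Z_t)_{0\le t\le T}$ such that $$\mathbb E\Big[\sup_{0\le t\le T}\big(|X_t|^2+|Y_t|^2\big)+\int_0^T|Z_t|^2\,dt\Big]<\infty .$$ Put $\hat a_t:=\hat a(t,X_t,\mu_t,Y_t)$ for $0\le t\le T$. Then for every admissible control $(a_t)_{0\le t\le T}$, $$ J(\hat a;\mu)+\lambda\,\mathbb E\int_0^T|a_t-\hat a_t|^2\,dt\le J(a;\mu). $$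
   Context: Fix $T>0$, a constant $\sigma\in\mathbb R$, and a filtered probability space $(\Omega,\mathcal F,(\mathcal F_t)_{0\le t\le T},\mathbb P)$ carrying a one-dimensional Brownian motion $W$, where the filtration is generated by $W$ and augmented by the $\mathbb P$-null sets. Let $x_0$ be a square-integrable $\mathcal F_0$-measurable real initial condition. $\mathcal P_2(\mathbb R)$ is the set of probability measures on $\mathbb R$ with finite second moment. A bounded flow in $\mathcal P_2(\mathbb R)$ is one with $\sup_{t}\int|x|^2d\mu_t(x)<\infty$, and bounded subsets of $\mathcal P_2(\mathbb R)$ are understood in the same sense. Controls: $A\subset\mathbb R$ is compact and convex. An admissible control is an $A$-valued progressively measurable process $(a_t)_{0\le t\le T}$. Its state process $X^a$ solves $dX^a_t=b(t,X^a_t,\mu_t,a_t)\,dt+\sigma\,dW_t$, $X^a_0=x_0$. The cost is $$J(a;\mu)=\mathbb E\Big[\int_0^T f(t,X^a_t,\mu_t,a_t)\,dt+g(X^a_T,\mu_T)\Big].$$ The coefficients are measurable functions $b,f:[0,T]\times\mathbb R\times\mathcal P_2(\mathbb R)\times A\to\mathbb R$, $g:\mathbb R\times\mathcal P_2(\mathbb R)\to\mathbb R$. Standing assumptions: (i) $b(t,x,\mu,a)=b_0(t,\mu)+b_1(t)x+b_2(t)a$, where $b_2$ is measurable and bounded on $[0,T]$, $b_0$ is measurable and bounded on bounded subsets of $[0,T]\times\mathcal P_2(\mathbb R)$, and $b_1$ is measurable and bounded on $[0,T]$. (ii) $f(t,\cdot,\mu,\cdot)$ is $C^{1,1}$ on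 $\mathbb R\times A$ (continuously differentiable with Lipschitz derivatives, one-sided in $a$ at the endpoints of $A$), $f$ is bounded with bounded derivatives in $x,a$, and there is $\lambda>0$ such that for all $t,\mu$ and all $x,x'\in\mathbb R$, $a,a'\in A$, $$f(t,x',\mu,a')-f(t,x,\mu,a)-(x'-x)\frac{\partial f}{\partial x}(t,x,\mu,a)-(a'-a)\frac{\partial f}{\partial a}(t,x,\mu,a)\ \ge\ \lambda|a'-a|^2 .$$ (iii) $g$ is bounded and, for every $\mu\in\mathcal P_2(\mathbb R)$, the function $x\mapsto g(x,\mu)$ is $C^1$ and convex. The Hamiltonian is $H(t,x,\mu,y,a)=b(t,x,\mu,a)\,y+f(t,x,\mu,a)$. Under these assumptions $a\mapsto H(t,x,\mu,y,a)$ is strongly convex on $A$, so its minimizer $\hat a(t,x,\mu,y)$ over $A$ is unique. *)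

theory Defs
  imports "HOL-Probability.Probability"
begin

section \<open>The space of probability measures with finite second moment\<close>

definition P2 :: "real measure set" where
  "P2 = {\<mu> \<in> space (prob_algebra borel). integrable \<mu> (\<lambda>x. x\<^sup>2)}"

text \<open>
  The trace on \<^const>\<open>P2\<close> of the \<sigma>-algebra generated by the evaluations \<open>\<mu> \<mapsto> \<mu>(B)\<close>, \<open>B\<close> Borel.
  It coincides with the Borel \<sigma>-algebra of the 2-Wasserstein distance.
\<close>
definition P2_algebra :: "real measure measure" where
  "P2_algebra = restrict_space (prob_algebra borel) P2"

definition bounded_flow :: "real \<Rightarrow> (real \<Rightarrow> real measure) \<Rightarrow> bool" where
  "bounded_flow T \<mu> \<longleftrightarrow>
     \<mu> \<in> restrict_space borel {0..T} \<rightarrow>\<^sub>M P2_algebra \<and>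
     (\<exists>C. \<forall>t\<in>{0..T}. (LINT x|\<mu> t. x\<^sup>2) \<le> C)"


section \<open>Brownian motion, its augmented filtration, and the stochastic integral\<close>

text \<open>
  Processes are curried functions of time and scenario; only times in \<open>{0..T}\<close> matter.
  Completeness of the ambient space \<open>M\<close> is not assumed; if \<open>M\<close> is complete then
  \<^term>\<open>null_sets M\<close> comprises all negligible sets.
\<close>
definition augmented_filtration ::
  "'a measure \<Rightarrow> (real \<Rightarrow> 'a \<Rightarrow> real) \<Rightarrow> real \<Rightarrow> 'a measure" where
  "augmented_filtration M W t =
     sigma (space M) ({W s -` B \<inter> space M | s B. s \<in> {0..t} \<and> B \<in> sets borel} \<union> null_sets M)"

definition brownian_motion :: "'a measure \<Rightarrow> real \<Rightarrow> (real \<Rightarrow> 'a \<Rightarrow> real) \<Rightarrow> bool" where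
  "brownian_motion M T W \<longleftrightarrow>
     prob_space M \<and>
     (\<forall>t\<in>{0..T}. W t \<in> borel_measurable M) \<and>
     (AE \<omega> in M. W 0 \<omega> = 0) \<and>
     (AE \<omega> in M. continuous_on {0..T} (\<lambda>t. W t \<omega>)) \<and>
     (\<forall>s t. 0 \<le> s \<longrightarrow> s < t \<longrightarrow> t \<le> T \<longrightarrow>
        distributed M lborel (\<lambda>\<omega>. W t \<omega> - W s \<omega>) (normal_density 0 (sqrt (t - s))) \<and>
        prob_space.indep_set M (sets (augmented_filtration M W s))
          (sets (vimage_algebra (space M) (\<lambda>\<omega>. W t \<omega> - W s \<omega>) borel)))"

definition progressive ::
  "'a measure \<Rightarrow> real \<Rightarrow> (real \<Rightarrow> 'a \<Rightarrow> real) \<Rightarrow> (real \<Rightarrow> 'a \<Rightarrow> real) \<Rightarrow> bool" where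
  "progressive M T W V \<longleftrightarrow>
     (\<forall>t\<in>{0..T}. (\<lambda>(s, \<omega>). V s \<omega>)
        \<in> borel_measurable (restrict_space borel {0..t} \<Otimes>\<^sub>M augmented_filtration M W t))"

definition continuous_progressive ::
  "'a measure \<Rightarrow> real \<Rightarrow> (real \<Rightarrow> 'a \<Rightarrow> real) \<Rightarrow> (real \<Rightarrow> 'a \<Rightarrow> real) \<Rightarrow> bool" where
  "continuous_progressive M T W V \<longleftrightarrow>
     progressive M T W V \<and> (AE \<omega> in M. continuous_on {0..T} (\<lambda>t. V t \<omega>))"

text \<open>
  A simple integrand is a finite list of triples \<open>(s, u, \<xi>)\<close>, standing for the finite sum of the
  processes \<open>\<xi> \<cdot> 1\<^bsub>(s, u]\<^esub>\<close> with \<open>\<xi>\<close> bounded and measurable at time \<open>s\<close>. The intervals may overlap.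
\<close>
type_synonym 'a simple_integrand = "(real \<times> real \<times> ('a \<Rightarrow> real)) list"

definition is_simple ::
  "'a measure \<Rightarrow> real \<Rightarrow> (real \<Rightarrow> 'a \<Rightarrow> real) \<Rightarrow> 'a simple_integrand \<Rightarrow> bool" where
  "is_simple M T W L \<longleftrightarrow>
     (\<forall>(s, u, \<xi>) \<in> set L. 0 \<le> s \<and> s \<le> u \<and> u \<le> T \<and>
        \<xi> \<in> borel_measurable (augmented_filtration M W s) \<and>
        (\<exists>C. \<forall>\<omega>\<in>space M. \<bar>\<xi> \<omega>\<bar> \<le> C))"

definition simple_process :: "'a simple_integrand \<Rightarrow> real \<Rightarrow> 'a \<Rightarrow> real" where
  "simple_process L t \<omega> = (\<Sum>(s, u, \<xi>)\<leftarrow>L. \<xi> \<omega> * indicator {s<..u} t)"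

definition simple_integral ::
  "(real \<Rightarrow> 'a \<Rightarrow> real) \<Rightarrow> 'a simple_integrand \<Rightarrow> real \<Rightarrow> 'a \<Rightarrow> real" where
  "simple_integral W L t \<omega> = (\<Sum>(s, u, \<xi>)\<leftarrow>L. \<xi> \<omega> * (W (min t u) \<omega> - W (min t s) \<omega>))"

text \<open>
  \<open>I\<close> is a continuous version of \<open>t \<mapsto> \<integral>\<^sub>0\<^sup>t Z dW\<close> for a square-integrable integrand \<open>Z\<close>: both
  the integrand and the integral are mean-square limits along a common sequence of simple
  integrands. Square integrability of \<open>Z\<close> is implied by the first limit.
\<close>
definition ito_integral ::
  "'a measure \<Rightarrow> real \<Rightarrow> (real \<Rightarrow> 'a \<Rightarrow> real) \<Rightarrow> (real \<Rightarrow> 'a \<Rightarrow> real) \<Rightarrow> (real \<Rightarrow> 'a \<Rightarrow> real) \<Rightarrow> bool"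
  where
  "ito_integral M T W Z I \<longleftrightarrow>
     progressive M T W Z \<and> continuous_progressive M T W I \<and>
     (\<exists>L. (\<forall>n. is_simple M T W (L n)) \<and>
        (\<lambda>n. \<integral>\<^sup>+\<omega>. (\<integral>\<^sup>+t\<in>{0..T}. ennreal ((Z t \<omega> - simple_process (L n) t \<omega>)\<^sup>2) \<partial>lborel) \<partial>M)
          \<longlonglongrightarrow> 0 \<and>
        (\<forall>t\<in>{0..T}.
          (\<lambda>n. \<integral>\<^sup>+\<omega>. ennreal ((I t \<omega> - simple_integral W (L n) t \<omega>)\<^sup>2) \<partial>M) \<longlonglongrightarrow> 0))"


section \<open>Coefficients and standing assumptions\<close>

type_synonym coeff = "real \<Rightarrow> real \<Rightarrow> real measure \<Rightarrow> real \<Rightarrow> real"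

definition measurable_coeff :: "real \<Rightarrow> real set \<Rightarrow> coeff \<Rightarrow> bool" where
  "measurable_coeff T A h \<longleftrightarrow>
     (\<lambda>(t, x, \<mu>, a). h t x \<mu> a) \<in> borel_measurable
       (restrict_space borel {0..T} \<Otimes>\<^sub>M borel \<Otimes>\<^sub>M P2_algebra \<Otimes>\<^sub>M restrict_space borel A)"

definition drift_assumption :: "real \<Rightarrow> real set \<Rightarrow> coeff \<Rightarrow> bool" where
  "drift_assumption T A b \<longleftrightarrow>
     measurable_coeff T A b \<and>
     (\<exists>b0 b1 b2.
        (\<forall>t\<in>{0..T}. \<forall>x. \<forall>\<mu>\<in>P2. \<forall>a\<in>A. b t x \<mu> a = b0 t \<mu> + b1 t * x + b2 t * a) \<and>
        (\<lambda>(t, \<mu>). b0 t \<mu>) \<in> borel_measurable (restrict_space borel {0..T} \<Otimes>\<^sub>M P2_algebra) \<and>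
        (\<forall>K. \<exists>C. \<forall>t\<in>{0..T}. \<forall>\<mu>\<in>P2. (LINT x|\<mu>. x\<^sup>2) \<le> K \<longrightarrow> \<bar>b0 t \<mu>\<bar> \<le> C) \<and>
        b1 \<in> borel_measurable (restrict_space borel {0..T}) \<and>
        (\<exists>C. \<forall>t\<in>{0..T}. \<bar>b1 t\<bar> \<le> C) \<and>
        b2 \<in> borel_measurable (restrict_space borel {0..T}) \<and>
        (\<exists>C. \<forall>t\<in>{0..T}. \<bar>b2 t\<bar> \<le> C))"

definition partial_x :: "coeff \<Rightarrow> coeff" where
  "partial_x h t x \<mu> a = deriv (\<lambda>x. h t x \<mu> a) x"

text \<open>
  The derivative in \<open>a\<close> is relative to \<open>A\<close>, hence one-sided at the endpoints of \<open>A\<close>. If \<open>A\<close> is a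
  singleton its value is an arbitrary constant, which is immaterial below: it is only
  ever multiplied by differences of elements of \<open>A\<close>.
\<close>
definition partial_a :: "real set \<Rightarrow> coeff \<Rightarrow> coeff" where
  "partial_a A h t x \<mu> a = vector_derivative (\<lambda>a. h t x \<mu> a) (at a within A)"

definition running_cost_assumption :: "real \<Rightarrow> real set \<Rightarrow> real \<Rightarrow> coeff \<Rightarrow> bool" where
  "running_cost_assumption T A lam f \<longleftrightarrow>
     measurable_coeff T A f \<and>
     (\<forall>t\<in>{0..T}. \<forall>\<mu>\<in>P2.
        (\<forall>x. \<forall>a\<in>A. ((\<lambda>(x, a). f t x \<mu> a) has_derivative
            (\<lambda>(u, v). partial_x f t x \<mu> a * u + partial_a A f t x \<mu> a * v))
            (at (x, a) within UNIV \<times> A)) \<and>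
        (\<exists>C. C-lipschitz_on (UNIV \<times> A) (\<lambda>(x, a). partial_x f t x \<mu> a)) \<and>
        (\<exists>C. C-lipschitz_on (UNIV \<times> A) (\<lambda>(x, a). partial_a A f t x \<mu> a))) \<and>
     (\<exists>C. \<forall>t\<in>{0..T}. \<forall>x. \<forall>\<mu>\<in>P2. \<forall>a\<in>A.
        \<bar>f t x \<mu> a\<bar> \<le> C \<and> \<bar>partial_x f t x \<mu> a\<bar> \<le> C \<and> \<bar>partial_a A f t x \<mu> a\<bar> \<le> C) \<and>
     (\<forall>t\<in>{0..T}. \<forall>\<mu>\<in>P2. \<forall>x x'. \<forall>a\<in>A. \<forall>a'\<in>A.
        f t x' \<mu> a' - f t x \<mu> a - (x' - x) * partial_x f t x \<mu> a
          - (a' - a) * partial_a A f t x \<mu> a \<ge> lam * \<bar>a' - a\<bar>\<^sup>2)"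

definition terminal_cost_assumption :: "(real \<Rightarrow> real measure \<Rightarrow> real) \<Rightarrow> bool" where
  "terminal_cost_assumption g \<longleftrightarrow>
     (\<lambda>(x, \<mu>). g x \<mu>) \<in> borel_measurable (borel \<Otimes>\<^sub>M P2_algebra) \<and>
     (\<exists>C. \<forall>x. \<forall>\<mu>\<in>P2. \<bar>g x \<mu>\<bar> \<le> C) \<and>
     (\<forall>\<mu>\<in>P2. (\<lambda>x. g x \<mu>) C1_differentiable_on UNIV \<and> convex_on UNIV (\<lambda>x. g x \<mu>))"

definition hamiltonian ::
  "coeff \<Rightarrow> coeff \<Rightarrow> real \<Rightarrow> real \<Rightarrow> real measure \<Rightarrow> real \<Rightarrow> real \<Rightarrow> real" where
  "hamiltonian b f t x \<mu> y a = b t x \<mu> a * y + f t x \<mu> a"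

definition hamiltonian_x ::
  "coeff \<Rightarrow> coeff \<Rightarrow> real \<Rightarrow> real \<Rightarrow> real measure \<Rightarrow> real \<Rightarrow> real \<Rightarrow> real" where
  "hamiltonian_x b f t x \<mu> y a = deriv (\<lambda>x. hamiltonian b f t x \<mu> y a) x"

definition hamiltonian_minimizer ::
  "real set \<Rightarrow> coeff \<Rightarrow> coeff \<Rightarrow> real \<Rightarrow> real \<Rightarrow> real measure \<Rightarrow> real \<Rightarrow> real" where
  "hamiltonian_minimizer A b f t x \<mu> y = arg_min_on (\<lambda>a. hamiltonian b f t x \<mu> y a) A"


section \<open>Controlled state, cost functional and the forward-backward system\<close>

definition admissible ::
  "'a measure \<Rightarrow> real \<Rightarrow> (real \<Rightarrow> 'a \<Rightarrow> real) \<Rightarrow> real set \<Rightarrow> (real \<Rightarrow> 'a \<Rightarrow> real) \<Rightarrow> bool" where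
  "admissible M T W A a \<longleftrightarrow>
     progressive M T W a \<and> (\<forall>t\<in>{0..T}. \<forall>\<omega>\<in>space M. a t \<omega> \<in> A)"

text \<open>\<open>dX = b(t, X, \<mu>, a) dt + \<sigma> dW\<close> with \<open>X\<^sub>0 = x0\<close>; as \<open>\<sigma>\<close> is constant, \<open>\<integral>\<^sub>0\<^sup>t \<sigma> dW = \<sigma> W\<^sub>t\<close>.\<close>
definition state_process ::
  "'a measure \<Rightarrow> real \<Rightarrow> (real \<Rightarrow> 'a \<Rightarrow> real) \<Rightarrow> real \<Rightarrow> ('a \<Rightarrow> real) \<Rightarrow> coeff \<Rightarrow>
   (real \<Rightarrow> real measure) \<Rightarrow> (real \<Rightarrow> 'a \<Rightarrow> real) \<Rightarrow> (real \<Rightarrow> 'a \<Rightarrow> real) \<Rightarrow> bool" where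
  "state_process M T W \<sigma> x0 b \<mu> a X \<longleftrightarrow>
     continuous_progressive M T W X \<and>
     (AE \<omega> in M.
        set_integrable lborel {0..T} (\<lambda>s. b s (X s \<omega>) (\<mu> s) (a s \<omega>)) \<and>
        (\<forall>t\<in>{0..T}.
          X t \<omega> = x0 \<omega> + (LBINT s:{0..t}. b s (X s \<omega>) (\<mu> s) (a s \<omega>)) + \<sigma> * W t \<omega>))"

text \<open>
  \<open>J(a; \<mu>)\<close> is \<open>cost M T f g \<mu> X a\<close> for any state process \<open>X\<close> of \<open>a\<close>; these are
  all indistinguishable, because the drift is Lipschitz in the state.
\<close>
definition cost ::
  "'a measure \<Rightarrow> real \<Rightarrow> coeff \<Rightarrow> (real \<Rightarrow> real measure \<Rightarrow> real) \<Rightarrow> (real \<Rightarrow> real measure) \<Rightarrow>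
   (real \<Rightarrow> 'a \<Rightarrow> real) \<Rightarrow> (real \<Rightarrow> 'a \<Rightarrow> real) \<Rightarrow> real" where
  "cost M T f g \<mu> X a =
     (LINT \<omega>|M. (LBINT t:{0..T}. f t (X t \<omega>) (\<mu> t) (a t \<omega>)) + g (X T \<omega>) (\<mu> T))"

definition optimal_feedback ::
  "real set \<Rightarrow> coeff \<Rightarrow> coeff \<Rightarrow> (real \<Rightarrow> real measure) \<Rightarrow>
   (real \<Rightarrow> 'a \<Rightarrow> real) \<Rightarrow> (real \<Rightarrow> 'a \<Rightarrow> real) \<Rightarrow> real \<Rightarrow> 'a \<Rightarrow> real" where
  "optimal_feedback A b f \<mu> X Y t \<omega> = hamiltonian_minimizer A b f t (X t \<omega>) (\<mu> t) (Y t \<omega>)"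

definition fbsde_solution ::
  "'a measure \<Rightarrow> real \<Rightarrow> (real \<Rightarrow> 'a \<Rightarrow> real) \<Rightarrow> real \<Rightarrow> ('a \<Rightarrow> real) \<Rightarrow> real set \<Rightarrow> coeff \<Rightarrow> coeff \<Rightarrow>
   (real \<Rightarrow> real measure \<Rightarrow> real) \<Rightarrow> (real \<Rightarrow> real measure) \<Rightarrow>
   (real \<Rightarrow> 'a \<Rightarrow> real) \<Rightarrow> (real \<Rightarrow> 'a \<Rightarrow> real) \<Rightarrow> (real \<Rightarrow> 'a \<Rightarrow> real) \<Rightarrow> bool" where
  "fbsde_solution M T W \<sigma> x0 A b f g \<mu> X Y Z \<longleftrightarrow>
     state_process M T W \<sigma> x0 b \<mu> (optimal_feedback A b f \<mu> X Y) X \<and>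
     continuous_progressive M T W Y \<and>
     (\<exists>I. ito_integral M T W Z I \<and>
       (AE \<omega> in M.
          set_integrable lborel {0..T}
            (\<lambda>s. hamiltonian_x b f s (X s \<omega>) (\<mu> s) (Y s \<omega>) (optimal_feedback A b f \<mu> X Y s \<omega>)) \<and>
          (\<forall>t\<in>{0..T}. Y t \<omega> = Y 0 \<omega>
            - (LBINT s:{0..t}.
                hamiltonian_x b f s (X s \<omega>) (\<mu> s) (Y s \<omega>) (optimal_feedback A b f \<mu> X Y s \<omega>))
            + I t \<omega>) \<and>
          Y T \<omega> = deriv (\<lambda>x. g x (\<mu> T)) (X T \<omega>)))"

end

theory Submission
  imports Defs
begin

text \<open>
  Let \<open>D = X - Xa\<close>. The noise cancels, so \<open>D\<close> is absolutely continuous with derivative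
  \<open>\<beta> = b1 * D + b2 * (ahat - a)\<close>, bounded by Gronwall's inequality. The growth condition on \<open>f\<close>, the
  first-order condition for \<open>ahat\<close> and the convexity of \<open>g\<close> bound the difference of the two costs
  along each path from below by \<open>lam * \<integral> \<bar>a - ahat\<bar>\<^sup>2 dt + \<integral> (\<beta> * Y - D * h) dt - Y T * D T\<close>, where
  \<open>h\<close> is the \<open>x\<close>-derivative of the Hamiltonian. Because \<open>D\<close> has no martingale part, Fubini's
  theorem on the triangle (instead of Ito's formula) turns the last two terms into
  \<open>- \<integral> \<beta> s * (I T - I s) ds\<close> with \<open>I = \<integral> Z dW\<close>. As \<open>\<beta> s\<close> is measurable at time \<open>s\<close>, the martingale
  property of \<open>I\<close> makes the expectation of this integral vanish.
\<close>

section \<open>Minimizers, Gronwall's inequality and integration by parts\<close>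

text \<open>Treating the product of \<open>Y\<close> and \<open>D\<close> path by path leaves a
  single probabilistic fact to prove: \<open>I T - I s\<close> is orthogonal to every
  square-integrable variable known at time \<open>s\<close>. Two obstacles shape the rest. The
  minimizer is a Hilbert choice without a formula, so measurability of \<open>ahat\<close> has to be
  derived from uniqueness of the minimizer and separability of \<open>A\<close>; without it neither
  would \<open>\<beta> s\<close> be known at time \<open>s\<close> nor the running cost be
  integrable. Moreover, exchanging time and expectation requires joint integrability of
  \<open>\<beta> s * (I T - I s)\<close>. This is why the Gronwall bound on \<open>\<beta>\<close>
  is deterministic and why \<open>I\<close> is estimated by solving the backward equation for it.
  The constant \<open>lam\<close> reaches the conclusion undiminished because the drift is affine in
  state and control: its share of the Hamiltonian is reproduced exactly by linear terms, and the
  growth condition on \<open>f\<close> supplies all the convexity.\<close>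

lemma arg_min_on_compact:
  fixes h :: "real \<Rightarrow> real"
  assumes "compact A" "A \<noteq> {}" "continuous_on A h"
  shows "arg_min_on h A \<in> A" "\<And>a. a \<in> A \<Longrightarrow> h (arg_min_on h A) \<le> h a"
proof -
  obtain m where "m \<in> A" "\<forall>y\<in>A. h m \<le> h y"
    using continuous_attains_inf[OF assms] by auto
  then have "is_arg_min h (\<lambda>x. x \<in> A) m"
    by (simp add: is_arg_min_linorder)
  then have "is_arg_min h (\<lambda>x. x \<in> A) (arg_min_on h A)"
    unfolding arg_min_on_def arg_min_def by (rule someI)
  then show "arg_min_on h A \<in> A" "\<And>a. a \<in> A \<Longrightarrow> h (arg_min_on h A) \<le> h a"
    by (auto simp: is_arg_min_linorder)
qed

text \<open>A sequence of \<open>D\<close> tending to \<open>x\<close> stays in \<open>S\<close>, so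
  continuity relative to \<open>S\<close> carries a strict bound at \<open>x\<close> over to
  \<open>D\<close>. \<open>S\<close> may fail to be closed, as does a piece like
  \<open>A \<inter> {c<..}\<close>.\<close>

lemma less_on_relatively_dense:
  fixes h :: "real \<Rightarrow> real"
  assumes "continuous_on S h" "D \<subseteq> S" "S \<subseteq> closure D" "x \<in> S" "h x < u"
  obtains d where "d \<in> D" "h d < u"
proof -
  obtain X where X: "\<And>n. X n \<in> D" "X \<longlonglongrightarrow> x"
    using assms(3,4) by (meson closure_sequential subsetD)
  have "(\<lambda>n. h (X n)) \<longlonglongrightarrow> h x"
    using X(1) assms(2)
    by (intro continuous_on_tendsto_compose[OF assms(1) X(2) assms(4)] always_eventually) auto
  then have "eventually (\<lambda>n. h (X n) < u) sequentially"
    using assms(5) by (rule order_tendstoD)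
  then obtain n where "h (X n) < u"
    unfolding eventually_sequentially by blast
  with X(1) show thesis
    by (rule that)
qed

text \<open>
  By continuity and uniqueness, the minimizer exceeds \<open>c\<close> iff some point above \<open>c\<close> beats all
  points up to \<open>c\<close>, and it suffices to compare points of two countable dense sets.
\<close>
lemma borel_measurable_arg_min_on:
  fixes h :: "'b \<Rightarrow> real \<Rightarrow> real"
  assumes A: "compact A" "A \<noteq> {}"
    and cont: "\<And>w. w \<in> space N \<Longrightarrow> continuous_on A (h w)"
    and uniq: "\<And>w p. w \<in> space N \<Longrightarrow> p \<in> A \<Longrightarrow> h w p \<le> h w (arg_min_on (h w) A) \<Longrightarrow>
      p = arg_min_on (h w) A"
    and meas: "\<And>a. a \<in> A \<Longrightarrow> (\<lambda>w. h w a) \<in> borel_measurable N"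
  shows "(\<lambda>w. arg_min_on (h w) A) \<in> borel_measurable N"
proof (rule borel_measurable_iff_greater[THEN iffD2], rule allI)
  fix c :: real
  obtain P where P: "countable P" "P \<subseteq> A \<inter> {c<..}" "A \<inter> {c<..} \<subseteq> closure P"
    by (rule separable)
  obtain Q where Q: "countable Q" "Q \<subseteq> A \<inter> {..c}" "A \<inter> {..c} \<subseteq> closure Q"
    by (rule separable)
  have eq: "c < arg_min_on (h w) A \<longleftrightarrow> (\<exists>p\<in>P. \<forall>q\<in>Q. h w p < h w q)" if w: "w \<in> space N" for w
  proof
    let ?m = "arg_min_on (h w) A"
    note m = arg_min_on_compact[OF A cont[OF w]]
    have cP: "continuous_on (A \<inter> {c<..}) (h w)" and cQ: "continuous_on (A \<inter> {..c}) (h w)"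
      by (rule continuous_on_subset[OF cont[OF w] Int_lower1])+
    show "\<exists>p\<in>P. \<forall>q\<in>Q. h w p < h w q" if c: "c < ?m"
    proof (cases "A \<inter> {..c} = {}")
      case True
      \<comment> \<open>\<open>Q\<close> is empty here and the inner quantifier vacuous; the slack 1
        is an arbitrary positive number that yields some member of \<open>P\<close>.\<close>
      moreover obtain p where "p \<in> P" "h w p < h w ?m + 1"
        using less_on_relatively_dense[OF cP P(2,3), of ?m "h w ?m + 1"] c m(1) by auto
      ultimately show ?thesis
        using Q(2) by auto
    next
      case False
      moreover have "compact (A \<inter> {..c})"
        using A by (intro compact_Int_closed) auto
      ultimately obtain q0 where q0: "q0 \<in> A \<inter> {..c}" "\<forall>y\<in>A \<inter> {..c}. h w q0 \<le> h w y"
        using continuous_attains_inf[OF _ _ cQ] by blast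
      \<comment> \<open>Strictness comes from uniqueness, since \<open>q0\<close> is at most
        \<open>c\<close> and \<open>?m\<close> is above it. The gap leaves room for a point of
        \<open>P\<close>.\<close>
      have "h w ?m < h w q0"
      proof (rule ccontr)
        assume "\<not> h w ?m < h w q0"
        then have "q0 = ?m"
          using q0(1) by (intro uniq[OF w]) auto
        with q0(1) c show False by auto
      qed
      then obtain p where "p \<in> P" "h w p < h w q0"
        using less_on_relatively_dense[OF cP P(2,3), of ?m "h w q0"] c m(1) by auto
      moreover have "h w q0 \<le> h w q" if "q \<in> Q" for q
        using q0(2) Q(2) that by auto
      ultimately show ?thesis
        by (meson less_le_trans)
    qed
    show "c < ?m" if ex: "\<exists>p\<in>P. \<forall>q\<in>Q. h w p < h w q"
    proof (rule ccontr)
      assume n: "\<not> c < ?m"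
      obtain p where p: "p \<in> P" "\<And>q. q \<in> Q \<Longrightarrow> h w p < h w q"
        using ex by auto
      \<comment> \<open>Otherwise some \<open>q\<close> close to \<open>?m\<close> would already
        beat \<open>p\<close>. Hence \<open>p\<close> is a minimizer too, and uniqueness places
        \<open>?m\<close> above \<open>c\<close>.\<close>
      have "h w p \<le> h w ?m"
      proof (rule ccontr)
        assume "\<not> h w p \<le> h w ?m"
        then obtain q where "q \<in> Q" "h w q < h w p"
          using less_on_relatively_dense[OF cQ Q(2,3), of ?m "h w p"] n m(1) by auto
        with p(2)[of q] show False by simp
      qed
      then have "p = ?m"
        using p(1) P(2) by (intro uniq[OF w]) auto
      with p(1) P(2) n show False by auto
    qed
  qed
  have "(\<Union>p\<in>P. space N - (\<Union>q\<in>Q. {w \<in> space N. h w q \<le> h w p})) \<in> sets N"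
  proof (intro sets.countable_UN'' sets.Diff sets.top P(1) Q(1))
    fix p q assume "p \<in> P" "q \<in> Q"
    then show "{w \<in> space N. h w q \<le> h w p} \<in> sets N"
      using P(2) Q(2) meas by (intro borel_measurable_le) auto
  qed
  moreover have "{w \<in> space N. c < arg_min_on (h w) A} =
      (\<Union>p\<in>P. space N - (\<Union>q\<in>Q. {w \<in> space N. h w q \<le> h w p}))" (is "?L = ?R")
  proof (rule set_eqI)
    show "w \<in> ?L \<longleftrightarrow> w \<in> ?R" for w
      by (cases "w \<in> space N") (simp_all add: eq not_le)
  qed
  ultimately show "{w \<in> space N. c < arg_min_on (h w) A} \<in> sets N"
    by simp
qed

text \<open>The weight \<open>exp (- (2 * K + 1) * t)\<close> makes the integral operator a contraction with factor \<open>1/2\<close>.\<close>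
lemma gronwall_bound:
  fixes D \<beta> :: "real \<Rightarrow> real"
  assumes "0 \<le> T" "0 \<le> K" "0 \<le> c"
    and cont: "continuous_on {0..T} D"
    and \<beta>: "set_integrable lborel {0..T} \<beta>"
    and eq: "\<And>t. t \<in> {0..T} \<Longrightarrow> D t = (LBINT s:{0..t}. \<beta> s)"
    and bound: "\<And>s. s \<in> {0..T} \<Longrightarrow> \<bar>\<beta> s\<bar> \<le> K * \<bar>D s\<bar> + c"
    and t: "t \<in> {0..T}"
  shows "\<bar>D t\<bar> \<le> 2 * c * T * exp ((2 * K + 1) * T)"
proof -
  \<comment> \<open>The summand 1 keeps \<open>k\<close> positive when \<open>K = 0\<close>, so that
    the antiderivative \<open>F\<close> may divide by \<open>k\<close>.\<close>
  define k where "k = 2 * K + 1"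
  have k: "k > 0" "K / k \<le> 1 / 2" using assms(2) by (auto simp: k_def field_simps)
  have "continuous_on {0..T} (\<lambda>t. exp (- k * t) * \<bar>D t\<bar>)"
    by (intro continuous_intros cont)
  then obtain m where m: "m \<in> {0..T}" "\<And>t. t \<in> {0..T} \<Longrightarrow> exp (- k * t) * \<bar>D t\<bar> \<le> exp (- k * m) * \<bar>D m\<bar>"
    using continuous_attains_sup[of "{0..T}" "\<lambda>t. exp (- k * t) * \<bar>D t\<bar>"] assms(1) by auto
  define N where "N = exp (- k * m) * \<bar>D m\<bar>"
  have N0: "0 \<le> N" by (simp add: N_def)
  have D: "\<bar>D s\<bar> \<le> N * exp (k * s)" if "s \<in> {0..T}" for s
  proof -
    have "exp (- k * s) * \<bar>D s\<bar> \<le> N"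
      using m(2)[OF that] by (simp only: N_def)
    then show ?thesis by (simp add: exp_minus field_simps)
  qed
  define F where "F s = K * N * exp (k * s) / k + c * s" for s
  have F: "(LBINT s:{0..m}. K * N * exp (k * s) + c) = F m - F 0"
    "set_integrable lborel {0..m} (\<lambda>s. K * N * exp (k * s) + c)"
  proof -
    have "has_bochner_integral lborel (\<lambda>x. (K * N * exp (k * x) + c) * indicator {0..m} x) (F m - F 0)"
      by (rule has_bochner_integral_FTC_Icc_real)
         (use m k in \<open>auto simp: F_def intro!: derivative_eq_intros continuous_intros\<close>)
    then show "(LBINT s:{0..m}. K * N * exp (k * s) + c) = F m - F 0"
      "set_integrable lborel {0..m} (\<lambda>s. K * N * exp (k * s) + c)"
      by (auto simp: has_bochner_integral_iff set_lebesgue_integral_def set_integrable_def mult.commute)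
  qed
  have \<beta>m: "set_integrable lborel {0..m} \<beta>"
    using \<beta> by (rule set_integrable_subset) (use m in auto)
  have "\<bar>D m\<bar> = \<bar>LBINT s:{0..m}. \<beta> s\<bar>" using eq m by simp
  also have "\<dots> \<le> (LBINT s:{0..m}. \<bar>\<beta> s\<bar>)"
    using set_integral_norm_bound[OF \<beta>m] by simp
  also have "\<dots> \<le> (LBINT s:{0..m}. K * N * exp (k * s) + c)"
  proof (rule set_integral_mono)
    fix s assume s: "s \<in> {0..m}"
    then have "\<bar>\<beta> s\<bar> \<le> K * \<bar>D s\<bar> + c" using bound m by auto
    also have "\<dots> \<le> K * (N * exp (k * s)) + c"
      using D[of s] s m assms(2) by (intro add_right_mono mult_left_mono) auto
    finally show "\<bar>\<beta> s\<bar> \<le> K * N * exp (k * s) + c" by (simp add: mult.assoc)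
  qed (use F(2) set_integrable_norm[OF \<beta>m] in auto)
  also have "\<dots> = N * (K / k) * (exp (k * m) - 1) + c * m"
    unfolding F(1) by (simp add: F_def right_diff_distrib mult.commute[of K N])
  also have "\<dots> \<le> N * (1/2) * exp (k * m) + c * T * exp (k * m)"
  proof (rule add_mono)
    show "N * (K / k) * (exp (k * m) - 1) \<le> N * (1/2) * exp (k * m)"
      using N0 k m assms by (intro mult_mono) auto
    have "c * m * 1 \<le> c * T * exp (k * m)"
      using assms m k by (intro mult_mono) auto
    then show "c * m \<le> c * T * exp (k * m)" by simp
  qed
  finally have "\<bar>D m\<bar> \<le> (N / 2 + c * T) * exp (k * m)" by (simp add: algebra_simps)
  \<comment> \<open>\<open>N\<close> is an attained maximum, hence finite, and half of it can be
    absorbed; this is the origin of the factor 2 in the conclusion. The argument uses the integral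
    equation alone, as \<open>\<beta>\<close> is merely integrable and \<open>D\<close> need not be
    differentiable.\<close>
  then have "N \<le> N / 2 + c * T"
    by (simp add: N_def exp_minus field_simps)
  then have "N \<le> 2 * c * T" by simp
  have "\<bar>D t\<bar> \<le> N * exp (k * t)" using D t by auto
  also have "\<dots> \<le> 2 * c * T * exp (k * T)"
    using \<open>N \<le> 2 * c * T\<close> N0 t k assms by (intro mult_mono) auto
  finally show ?thesis by (simp add: k_def)
qed

text \<open>Both sides integrate \<open>\<beta> s * h r\<close> over the triangle
  \<open>s \<le> r\<close>, each in one order. The kernel is dominated by the product on the square,
  which is integrable as soon as both factors are.\<close>

lemma integral_by_parts_Fubini:
  fixes \<beta> h :: "real \<Rightarrow> real"
  assumes \<beta>: "set_integrable lborel {0..T} \<beta>" and h: "set_integrable lborel {0..T} h"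
  shows "set_integrable lborel {0..T} (\<lambda>s. \<beta> s * (LBINT r:{s..T}. h r))"
    and "set_integrable lborel {0..T} (\<lambda>r. (LBINT s:{0..r}. \<beta> s) * h r)"
    and "(LBINT s:{0..T}. \<beta> s * (LBINT r:{s..T}. h r)) = (LBINT r:{0..T}. (LBINT s:{0..r}. \<beta> s) * h r)"
proof -
  let ?\<beta> = "\<lambda>s. indicator {0..T} s * \<beta> s" and ?h = "\<lambda>r. indicator {0..T} r * h r"
  let ?G = "\<lambda>s r. ?\<beta> s * ?h r * (if s \<le> r then 1 else 0)"
  have i: "integrable lborel ?\<beta>" "integrable lborel ?h"
    using assms by (auto simp: set_integrable_def)
  have mh[measurable]: "?\<beta> \<in> borel_measurable borel" "?h \<in> borel_measurable borel"
    using i[THEN borel_measurable_integrable] by auto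
  have prod: "integrable (lborel \<Otimes>\<^sub>M lborel) (\<lambda>(s, r). ?\<beta> s * ?h r)"
    using i i[THEN integrable_abs] by (intro lborel_pair.Fubini_integrable) (auto simp: abs_mult)
  have G: "integrable (lborel \<Otimes>\<^sub>M lborel) (\<lambda>(s, r). ?G s r)"
    by (rule Bochner_Integration.integrable_bound[OF prod]) (auto simp: abs_mult)
  have 1: "(\<integral>r. ?G s r \<partial>lborel) = indicator {0..T} s * (\<beta> s * (LBINT r:{s..T}. h r))" for s
  proof (cases "s \<in> {0..T}")
    case True
    have "(\<integral>r. ?G s r \<partial>lborel) = (\<integral>r. \<beta> s * (indicator {s..T} r * h r) \<partial>lborel)"
      by (rule Bochner_Integration.integral_cong) (use True in \<open>auto simp: indicator_def\<close>)
    then show ?thesis using True by (simp add: set_lebesgue_integral_def)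
  qed simp
  have 2: "(\<integral>s. ?G s r \<partial>lborel) = indicator {0..T} r * ((LBINT s:{0..r}. \<beta> s) * h r)" for r
  proof (cases "r \<in> {0..T}")
    case True
    have "(\<integral>s. ?G s r \<partial>lborel) = (\<integral>s. (indicator {0..r} s * \<beta> s) * h r \<partial>lborel)"
      by (rule Bochner_Integration.integral_cong) (use True in \<open>auto simp: indicator_def\<close>)
    then show ?thesis using True by (simp add: set_lebesgue_integral_def)
  qed simp
  show "set_integrable lborel {0..T} (\<lambda>s. \<beta> s * (LBINT r:{s..T}. h r))"
    using lborel_pair.integrable_fst[OF G] unfolding 1 by (simp add: set_integrable_def)
  show "set_integrable lborel {0..T} (\<lambda>r. (LBINT s:{0..r}. \<beta> s) * h r)"
    using lborel_pair.integrable_snd[OF G] unfolding 2 by (simp add: set_integrable_def)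
  show "(LBINT s:{0..T}. \<beta> s * (LBINT r:{s..T}. h r)) = (LBINT r:{0..T}. (LBINT s:{0..r}. \<beta> s) * h r)"
    using lborel_pair.Fubini_integral[OF G] unfolding 1 2 by (simp add: set_lebesgue_integral_def)
qed

lemma set_integral_Icc_diff:
  fixes h :: "real \<Rightarrow> real"
  assumes h: "set_integrable lborel {0..T} h" and s: "s \<in> {0..T}"
  shows "(LBINT r:{s..T}. h r) = (LBINT r:{0..T}. h r) - (LBINT r:{0..s}. h r)"
proof -
  \<comment> \<open>The two intervals share the endpoint \<open>s\<close>, so they are disjoint up
    to a null set.\<close>
  have "AE r in lborel. \<not> (r \<in> {0..s} \<and> r \<in> {s..T})"
    using AE_lborel_singleton[of s] by eventually_elim auto
  moreover have "set_integrable lborel {0..s} h" "set_integrable lborel {s..T} h"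
    using s by (auto intro: set_integrable_subset[OF h])
  ultimately have "(LBINT r:{0..s}\<union>{s..T}. h r) = (LBINT r:{0..s}. h r) + (LBINT r:{s..T}. h r)"
    by (intro set_integral_Un_AE) auto
  moreover have "{0..s} \<union> {s..T} = {0..T}" using s by auto
  ultimately show ?thesis by simp
qed

section \<open>Time as a factor of a product measure\<close>

lemma LBINT_eq_restrict_space:
  fixes F :: "real \<Rightarrow> real"
  shows "(LBINT s:{0..T}. F s) = (\<integral>s. F s \<partial>restrict_space lborel {0..T})"
  by (simp add: set_lebesgue_integral_def integral_restrict_space)

lemma set_integrable_iff_restrict_space:
  fixes F :: "real \<Rightarrow> real"
  shows "set_integrable lborel {0..T} F \<longleftrightarrow> integrable (restrict_space lborel {0..T}) F"
  by (simp add: set_integrable_def integrable_restrict_space)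

text \<open>The product of the whole first space with a null set is null. With time as the first
  factor, estimates valid for almost every scenario and all times at once become almost-everywhere
  bounds on the product.\<close>

lemma (in pair_sigma_finite) AE_pair_snd:
  assumes "AE y in M2. Q y"
  shows "AE p in M1 \<Otimes>\<^sub>M M2. Q (snd p)"
proof -
  obtain N where N: "{y \<in> space M2. \<not> Q y} \<subseteq> N" "N \<in> null_sets M2"
    using assms unfolding eventually_ae_filter by blast
  have "space M1 \<times> N \<in> null_sets (M1 \<Otimes>\<^sub>M M2)"
    using N(2) by (intro M2.times_in_null_sets2) auto
  moreover have "{p \<in> space (M1 \<Otimes>\<^sub>M M2). \<not> Q (snd p)} \<subseteq> space M1 \<times> N"
    using N(1) by (auto simp: space_pair_measure)
  ultimately show ?thesis by (rule AE_I')
qed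

section \<open>The filtration and the stochastic integral\<close>

lemma space_augmented_filtration [simp]: "space (augmented_filtration M W t) = space M"
  by (simp add: augmented_filtration_def space_measure_of_conv)

lemma sets_augmented_filtration:
  "sets (augmented_filtration M W t) =
     sigma_sets (space M) ({W s -` B \<inter> space M | s B. s \<in> {0..t} \<and> B \<in> sets borel} \<union> null_sets M)"
  unfolding augmented_filtration_def
  using sets.sets_into_space[OF null_setsD2, of _ M] by (intro sets_measure_of) auto

lemma sets_augmented_filtration_mono:
  "s \<le> t \<Longrightarrow> sets (augmented_filtration M W s) \<subseteq> sets (augmented_filtration M W t)"
  unfolding sets_augmented_filtration
proof (intro sigma_sets_mono' Un_mono order_refl subsetI, elim CollectE exE conjE)
  fix V r B assume "s \<le> t" "V = W r -` B \<inter> space M" "r \<in> {0..s}" "B \<in> sets borel"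
  then show "V \<in> {W s -` B \<inter> space M |s B. s \<in> {0..t} \<and> B \<in> sets borel}"
    by (intro CollectI exI[of _ r] exI[of _ B]) auto
qed

lemma borel_measurable_augmented_filtration_mono:
  assumes "V \<in> borel_measurable (augmented_filtration M W s)" "s \<le> t"
  shows "V \<in> borel_measurable (augmented_filtration M W t)"
  using assms sets_augmented_filtration_mono[OF assms(2), of M W] by (auto simp: measurable_def)

lemma sets_augmented_filtration_subset:
  assumes "brownian_motion M T W" "t \<le> T"
  shows "sets (augmented_filtration M W t) \<subseteq> sets M"
  unfolding sets_augmented_filtration
proof (rule sets.sigma_sets_subset, rule Un_least)
  show "{W s -` B \<inter> space M |s B. s \<in> {0..t} \<and> B \<in> sets borel} \<subseteq> sets M"
  proof (rule subsetI, elim CollectE exE conjE)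
    fix V s B assume V: "V = W s -` B \<inter> space M" "s \<in> {0..t}" "B \<in> sets borel"
    have "W s \<in> borel_measurable M"
      using V(2) assms unfolding brownian_motion_def by auto
    then show "V \<in> sets M"
      unfolding V(1) using V(3) by (rule measurable_sets)
  qed
qed auto

lemma borel_measurable_augmented_filtration:
  assumes "brownian_motion M T W" "t \<le> T" "V \<in> borel_measurable (augmented_filtration M W t)"
  shows "V \<in> borel_measurable M"
  using assms(3) sets_augmented_filtration_subset[OF assms(1,2)] by (auto simp: measurable_def)

lemma progressive_adapted:
  assumes "progressive M T W V" "t \<in> {0..T}"
  shows "V t \<in> borel_measurable (augmented_filtration M W t)"
proof -
  have V: "(\<lambda>(s, \<omega>). V s \<omega>) \<in> borel_measurable (restrict_space borel {0..t} \<Otimes>\<^sub>M augmented_filtration M W t)"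
    using assms unfolding progressive_def by blast
  have "t \<in> space (restrict_space borel {0..t})"
    using assms(2) by simp
  from measurable_compose[OF measurable_Pair1'[OF this] V] show ?thesis by simp
qed

text \<open>The identity between the two products is measurable: \<open>lborel\<close> has the Borel
  sets, and the sets of the filtration at time \<open>T\<close> belong to \<open>M\<close>. The
  result is the joint measurability that Fubini's theorem asks for.\<close>

lemma progressive_measurable:
  assumes "brownian_motion M T W" "0 \<le> T" "progressive M T W V" 
  shows "(\<lambda>(s, \<omega>). V s \<omega>) \<in> borel_measurable (restrict_space lborel {0..T} \<Otimes>\<^sub>M M)"
proof -
  have "(\<lambda>(s, \<omega>). V s \<omega>) \<in> borel_measurable (restrict_space borel {0..T} \<Otimes>\<^sub>M augmented_filtration M W T)"
    using assms by (auto simp: progressive_def)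
  moreover have id: "(\<lambda>p. p) \<in> (restrict_space lborel {0..T} \<Otimes>\<^sub>M M) \<rightarrow>\<^sub>M
      (restrict_space borel {0..T} \<Otimes>\<^sub>M augmented_filtration M W T)"
  proof -
    have "(\<lambda>p. (fst p, snd p)) \<in> (restrict_space lborel {0..T} \<Otimes>\<^sub>M M) \<rightarrow>\<^sub>M
      (restrict_space borel {0..T} \<Otimes>\<^sub>M augmented_filtration M W T)"
    proof (rule measurable_Pair)
      have "(\<lambda>x. x) \<in> restrict_space lborel {0..T} \<rightarrow>\<^sub>M restrict_space borel {0..T}"
        by (rule measurable_ident_sets) (rule sets_restrict_space_cong, simp)
      from measurable_compose[OF measurable_fst this]
      show "fst \<in> (restrict_space lborel {0..T} \<Otimes>\<^sub>M M) \<rightarrow>\<^sub>M restrict_space borel {0..T}" .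
      have "(\<lambda>x. x) \<in> M \<rightarrow>\<^sub>M augmented_filtration M W T"
        using sets_augmented_filtration_subset[OF assms(1), of T] sets.sets_into_space
        by (auto simp: measurable_def Int_absorb2 vimage_def)
      from measurable_compose[OF measurable_snd this]
      show "snd \<in> (restrict_space lborel {0..T} \<Otimes>\<^sub>M M) \<rightarrow>\<^sub>M augmented_filtration M W T" .
    qed
    then show ?thesis by simp
  qed
  ultimately show ?thesis
    using measurable_compose[OF id] by blast
qed

text \<open>Independence factorizes the expectation, so integrability of \<open>\<xi>\<close> is
  enough, and the normal increment has mean zero. The case \<open>s = u\<close> is separate because
  \<open>brownian_motion\<close> describes increments for \<open>s < t\<close>.\<close>

lemma brownian_increment:
  assumes W: "brownian_motion M T W" and s: "0 \<le> s" "s \<le> u" "u \<le> T"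
    and \<xi>: "\<xi> \<in> borel_measurable (augmented_filtration M W s)" "integrable M \<xi>"
  shows "integrable M (\<lambda>\<omega>. \<xi> \<omega> * (W u \<omega> - W s \<omega>))"
    and "(LINT \<omega>|M. \<xi> \<omega> * (W u \<omega> - W s \<omega>)) = 0"
proof -
  interpret prob_space M using W by (simp add: brownian_motion_def)
  have "integrable M (\<lambda>\<omega>. \<xi> \<omega> * (W u \<omega> - W s \<omega>)) \<and> (LINT \<omega>|M. \<xi> \<omega> * (W u \<omega> - W s \<omega>)) = 0"
  proof (cases "s = u")
    case False
    let ?d = "\<lambda>\<omega>. W u \<omega> - W s \<omega>"
    have su: "s < u" using s False by simp
    have dist: "distributed M lborel ?d (normal_density 0 (sqrt (u - s)))"
      and ind: "indep_set (sets (augmented_filtration M W s)) (sets (vimage_algebra (space M) ?d borel))"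
      using W s su unfolding brownian_motion_def by blast+
    have md: "?d \<in> borel_measurable M"
    proof (rule borel_measurable_diff)
      have "\<forall>t\<in>{0..T}. W t \<in> borel_measurable M"
        using W unfolding brownian_motion_def by blast
      then show "W u \<in> borel_measurable M" "W s \<in> borel_measurable M"
        using s by simp_all
    qed
    have m\<xi>: "\<xi> \<in> borel_measurable M"
      using \<xi>(2) by (rule borel_measurable_integrable)
    have "indep_var borel \<xi> borel ?d"
      unfolding indep_var_eq
    proof (intro conjI md m\<xi>)
      \<comment> \<open>Independence passes from the whole filtration at time \<open>s\<close> to
        the smaller sigma-algebra generated by \<open>\<xi>\<close>.\<close>
      have 1: "sigma_sets (space M) {\<xi> -` A \<inter> space M |A. A \<in> sets borel} \<subseteq> sets (augmented_filtration M W s)"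
      proof (rule sets.sigma_sets_subset[of _ "augmented_filtration M W s", simplified])
        show "{\<xi> -` A \<inter> space M |A. A \<in> sets borel} \<subseteq> sets (augmented_filtration M W s)"
          using measurable_sets[OF \<xi>(1)] by auto
      qed
      have 2: "sigma_sets (space M) {?d -` A \<inter> space M |A. A \<in> sets borel} = sets (vimage_algebra (space M) ?d borel)"
        by (simp add: sets_vimage_algebra)
      show "indep_set (sigma_sets (space M) {\<xi> -` A \<inter> space M |A. A \<in> sets borel})
          (sigma_sets (space M) {?d -` A \<inter> space M |A. A \<in> sets borel})"
        using ind unfolding 2 indep_set_def
        by (rule indep_sets_mono_sets) (use 1 in \<open>simp split: bool.split\<close>)
    qed
    moreover have "integrable M ?d"
      using distributed_integrable[OF dist, of "\<lambda>x. x"] su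
        integrable_normal_moment_nz_1[of "sqrt (u - s)" 0] by simp
    moreover have "expectation ?d = 0"
      using normal_distributed_expectation[OF _ dist] su by simp
    ultimately show ?thesis
      using indep_var_integrable[of \<xi> ?d] indep_var_lebesgue_integral[of \<xi> ?d] \<xi>(2) by simp
  qed simp
  then show "integrable M (\<lambda>\<omega>. \<xi> \<omega> * (W u \<omega> - W s \<omega>))"
    and "(LINT \<omega>|M. \<xi> \<omega> * (W u \<omega> - W s \<omega>)) = 0" by auto
qed

text \<open>By linearity it suffices to treat one triple. After time \<open>s\<close> it contributes
  \<open>\<eta>\<close> times the increment of \<open>W\<close> from \<open>max s r\<close> to
  \<open>u\<close>, or nothing if \<open>u \<le> s\<close>. The weight \<open>\<xi> * \<eta>\<close>
  is known at time \<open>max s r\<close> and integrable because \<open>\<eta>\<close> is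
  bounded.\<close>

lemma simple_integral_orthogonal:
  assumes W: "brownian_motion M T W" and s: "s \<in> {0..T}"
    and \<xi>: "\<xi> \<in> borel_measurable (augmented_filtration M W s)" "integrable M \<xi>"
    and L: "is_simple M T W L"
  shows "integrable M (\<lambda>\<omega>. \<xi> \<omega> * (simple_integral W L T \<omega> - simple_integral W L s \<omega>)) \<and>
    (LINT \<omega>|M. \<xi> \<omega> * (simple_integral W L T \<omega> - simple_integral W L s \<omega>)) = 0"
  using L
proof (induction L)
  case Nil
  then show ?case by (simp add: simple_integral_def)
next
  case (Cons p L)
  obtain r u \<eta> where p: "p = (r, u, \<eta>)" by (cases p)
  have L: "is_simple M T W L" and ru: "0 \<le> r" "r \<le> u" "u \<le> T"
    and \<eta>: "\<eta> \<in> borel_measurable (augmented_filtration M W r)"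
    using Cons.prems by (auto simp: is_simple_def p)
  obtain C where C: "\<And>\<omega>. \<omega> \<in> space M \<Longrightarrow> \<bar>\<eta> \<omega>\<bar> \<le> C"
    using Cons.prems by (auto simp: is_simple_def p)
  let ?q = "max s r"
  let ?e = "\<lambda>\<omega>. \<xi> \<omega> * (\<eta> \<omega> * (W (min T u) \<omega> - W (min T r) \<omega>) - \<eta> \<omega> * (W (min s u) \<omega> - W (min s r) \<omega>))"
  have m\<eta>: "\<eta> \<in> borel_measurable M"
    using borel_measurable_augmented_filtration[OF W _ \<eta>] ru by simp
  have m: "(\<lambda>\<omega>. \<xi> \<omega> * \<eta> \<omega>) \<in> borel_measurable (augmented_filtration M W ?q)"
    using borel_measurable_augmented_filtration_mono[OF \<xi>(1), of ?q]
      borel_measurable_augmented_filtration_mono[OF \<eta>, of ?q] by simp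
  have i: "integrable M (\<lambda>\<omega>. \<xi> \<omega> * \<eta> \<omega>)"
  proof (rule Bochner_Integration.integrable_bound)
    show "integrable M (\<lambda>\<omega>. C * \<xi> \<omega>)" using \<xi>(2) by simp
    show "AE \<omega> in M. norm (\<xi> \<omega> * \<eta> \<omega>) \<le> norm (C * \<xi> \<omega>)"
    proof (rule AE_I2)
      fix \<omega> assume "\<omega> \<in> space M"
      then have "\<bar>\<eta> \<omega>\<bar> \<le> \<bar>C\<bar>" using C by force
      then show "norm (\<xi> \<omega> * \<eta> \<omega>) \<le> norm (C * \<xi> \<omega>)"
        by (simp add: abs_mult mult.commute mult_right_mono)
    qed
  qed (use m\<eta> \<xi>(2) in auto)
  have e: "integrable M ?e \<and> integral\<^sup>L M ?e = 0"
  proof (cases "u \<le> s")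
    case True
    then have "min T u = u" "min T r = r" "min s u = u" "min s r = r" using ru s by auto
    then have "?e = (\<lambda>_. 0)" by simp
    then show ?thesis by simp
  next
    case False
    then have u: "min T u = u" "min T r = r" "min s u = s"
      using ru s by auto
    have "?e = (\<lambda>\<omega>. (\<xi> \<omega> * \<eta> \<omega>) * (W u \<omega> - W ?q \<omega>))"
      unfolding u by (cases "s \<le> r") (simp_all add: fun_eq_iff algebra_simps)
    then show ?thesis
      using brownian_increment[OF W _ _ _ m i, of u] s ru False by auto
  qed
  have split: "\<xi> \<omega> * (simple_integral W (p # L) T \<omega> - simple_integral W (p # L) s \<omega>) =
      ?e \<omega> + \<xi> \<omega> * (simple_integral W L T \<omega> - simple_integral W L s \<omega>)" for \<omega>
    by (simp add: simple_integral_def p algebra_simps)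
  show ?case
    unfolding split using e Cons.IH[OF L] by simp
qed

lemma simple_integral_measurable:
  assumes W: "brownian_motion M T W" and t: "t \<in> {0..T}" and L: "is_simple M T W L"
  shows "simple_integral W L t \<in> borel_measurable M"
  using L
proof (induction L)
  case Nil
  then show ?case by (simp add: simple_integral_def[abs_def])
next
  case (Cons p L)
  obtain r u \<eta> where p: "p = (r, u, \<eta>)" by (cases p)
  have L: "is_simple M T W L" and ru: "0 \<le> r" "r \<le> u" "u \<le> T"
    and \<eta>: "\<eta> \<in> borel_measurable (augmented_filtration M W r)"
    using Cons.prems by (auto simp: is_simple_def p)
  have "\<eta> \<in> borel_measurable M" "W (min t u) \<in> borel_measurable M" "W (min t r) \<in> borel_measurable M"
    using borel_measurable_augmented_filtration[OF W _ \<eta>] ru t W by (auto simp: brownian_motion_def)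
  then have "(\<lambda>\<omega>. \<eta> \<omega> * (W (min t u) \<omega> - W (min t r) \<omega>) + simple_integral W L t \<omega>) \<in> borel_measurable M"
    using Cons.IH[OF L] by (intro borel_measurable_add borel_measurable_times borel_measurable_diff)
  then show ?case by (simp add: simple_integral_def[abs_def] p)
qed

lemma ito_integral_measurable:
  assumes "brownian_motion M T W" "ito_integral M T W Z I" "t \<in> {0..T}"
  shows "I t \<in> borel_measurable M"
  using assms borel_measurable_augmented_filtration[OF assms(1) _ progressive_adapted[OF _ assms(3)]]
  by (auto simp: ito_integral_def continuous_progressive_def)

text \<open>
  The martingale property of the stochastic integral, inherited from simple integrands in the
  mean-square limit; Young's inequality replaces Cauchy--Schwarz.
\<close>
lemma ito_integral_orthogonal:
  assumes W: "brownian_motion M T W" and I: "ito_integral M T W Z I" and s: "s \<in> {0..T}"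
    and \<xi>: "\<xi> \<in> borel_measurable (augmented_filtration M W s)" "integrable M (\<lambda>\<omega>. (\<xi> \<omega>)\<^sup>2)"
  shows "integrable M (\<lambda>\<omega>. \<xi> \<omega> * (I T \<omega> - I s \<omega>))"
    and "(LINT \<omega>|M. \<xi> \<omega> * (I T \<omega> - I s \<omega>)) = 0"
proof -
  interpret prob_space M using W by (simp add: brownian_motion_def)
  have T: "T \<in> {0..T}" using s by simp
  have m\<xi>[measurable]: "\<xi> \<in> borel_measurable M"
    using borel_measurable_augmented_filtration[OF W _ \<xi>(1)] s by simp
  have \<xi>1: "integrable M \<xi>"
    using square_integrable_imp_integrable[OF m\<xi> \<xi>(2)] .
  obtain L where L: "\<And>n. is_simple M T W (L n)"
    and lim: "\<And>t. t \<in> {0..T} \<Longrightarrow>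
      (\<lambda>n. \<integral>\<^sup>+\<omega>. ennreal ((I t \<omega> - simple_integral W (L n) t \<omega>)\<^sup>2) \<partial>M) \<longlonglongrightarrow> 0"
    using I unfolding ito_integral_def by blast
  let ?S = "\<lambda>n. simple_integral W (L n)"
  have mI[measurable]: "I t \<in> borel_measurable M" if "t \<in> {0..T}" for t
    using ito_integral_measurable[OF W I that] .
  have mS[measurable]: "?S n t \<in> borel_measurable M" if "t \<in> {0..T}" for t n
    using simple_integral_measurable[OF W that L] .
  \<comment> \<open>The same \<open>e\<close> serves as the parameter in Young's inequality and,
    squared, as the bound on the mean-square error at the two times \<open>s\<close> and
    \<open>T\<close>. The error term \<open>e\<^sup>2 / e\<close> therefore still vanishes with
    \<open>e\<close>.\<close>
  have approx: "integrable M (\<lambda>\<omega>. \<xi> \<omega> * (I T \<omega> - I s \<omega>)) \<and> \<bar>LINT \<omega>|M. \<xi> \<omega> * (I T \<omega> - I s \<omega>)\<bar> \<le>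
      e * (LINT \<omega>|M. (\<xi> \<omega>)\<^sup>2) + e" if e: "0 < e" for e
  proof -
    have "eventually (\<lambda>n. (\<integral>\<^sup>+\<omega>. ennreal ((I t \<omega> - ?S n t \<omega>)\<^sup>2) \<partial>M) < ennreal (e\<^sup>2)) sequentially"
      if "t \<in> {0..T}" for t
      using order_tendstoD(2)[OF lim[OF that], of "ennreal (e\<^sup>2)"] e by simp
    from eventually_conj[OF this[OF s] this[OF T]]
    obtain n where n: "\<And>t. t \<in> {s, T} \<Longrightarrow> (\<integral>\<^sup>+\<omega>. ennreal ((I t \<omega> - ?S n t \<omega>)\<^sup>2) \<partial>M) < ennreal (e\<^sup>2)"
      by (auto simp: eventually_sequentially)
    let ?d = "\<lambda>t \<omega>. I t \<omega> - ?S n t \<omega>"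
    have d: "integrable M (\<lambda>\<omega>. (?d t \<omega>)\<^sup>2) \<and> (LINT \<omega>|M. (?d t \<omega>)\<^sup>2) \<le> e\<^sup>2" if t: "t \<in> {s, T}" for t
    proof -
      have t': "t \<in> {0..T}" using t s by auto
      have i: "integrable M (\<lambda>\<omega>. (?d t \<omega>)\<^sup>2)"
        using n[OF t] mI[OF t'] mS[OF t'] by (intro integrableI_nonneg) (auto simp: top.extremum_strict less_trans)
      then have "ennreal (LINT \<omega>|M. (?d t \<omega>)\<^sup>2) < ennreal (e\<^sup>2)"
        using n[OF t] by (simp add: nn_integral_eq_integral)
      with i show ?thesis by (simp add: ennreal_less_iff)
    qed
    let ?r = "\<lambda>\<omega>. \<xi> \<omega> * (?d T \<omega> - ?d s \<omega>)"
    let ?B = "\<lambda>\<omega>. e * (\<xi> \<omega>)\<^sup>2 + ((?d T \<omega>)\<^sup>2 + (?d s \<omega>)\<^sup>2) / (2 * e)"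
    have Young: "\<bar>?r \<omega>\<bar> \<le> ?B \<omega>" for \<omega>
    proof -
      have *: "\<bar>x * y\<bar> \<le> e / 2 * x\<^sup>2 + y\<^sup>2 / (2 * e)" for x y :: real
      proof -
        have "0 \<le> (e * \<bar>x\<bar> - \<bar>y\<bar>)\<^sup>2" by simp
        then have "2 * e * \<bar>x * y\<bar> \<le> e\<^sup>2 * x\<^sup>2 + y\<^sup>2"
          by (simp add: power2_diff power_mult_distrib abs_mult mult_ac)
        then show ?thesis using e by (simp add: field_simps power2_eq_square)
      qed
      have "\<bar>?r \<omega>\<bar> \<le> \<bar>\<xi> \<omega> * ?d T \<omega>\<bar> + \<bar>\<xi> \<omega> * ?d s \<omega>\<bar>"
        by (simp only: right_diff_distrib abs_triangle_ineq4)
      also have "\<dots> \<le> ?B \<omega>"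
        using *[of "\<xi> \<omega>" "?d T \<omega>"] *[of "\<xi> \<omega>" "?d s \<omega>"] by (simp add: add_divide_distrib)
      finally show ?thesis .
    qed
    have iB: "integrable M ?B" using \<xi>(2) d by auto
    have ir: "integrable M ?r"
      by (rule Bochner_Integration.integrable_bound[OF iB]) (use Young mI mS s T in \<open>auto intro: order_trans[OF _ abs_ge_self]\<close>)
    note S = simple_integral_orthogonal[OF W s \<xi>(1) \<xi>1 L, of n]
    have eq: "\<xi> \<omega> * (I T \<omega> - I s \<omega>) = ?r \<omega> + \<xi> \<omega> * (?S n T \<omega> - ?S n s \<omega>)" for \<omega>
      by (simp add: algebra_simps)
    have "\<bar>integral\<^sup>L M ?r\<bar> \<le> (LINT \<omega>|M. \<bar>?r \<omega>\<bar>)" by (rule integral_abs_bound)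
    also have "\<dots> \<le> integral\<^sup>L M ?B"
      using ir iB Young by (intro integral_mono) auto
    also have "\<dots> = e * (LINT \<omega>|M. (\<xi> \<omega>)\<^sup>2) + ((LINT \<omega>|M. (?d T \<omega>)\<^sup>2) + (LINT \<omega>|M. (?d s \<omega>)\<^sup>2)) / (2 * e)"
      using \<xi>(2) d by simp
    also have "\<dots> \<le> e * (LINT \<omega>|M. (\<xi> \<omega>)\<^sup>2) + (e\<^sup>2 + e\<^sup>2) / (2 * e)"
      using d e by (intro add_left_mono divide_right_mono add_mono) auto
    also have "\<dots> = e * (LINT \<omega>|M. (\<xi> \<omega>)\<^sup>2) + e"
      using e by (simp add: power2_eq_square)
    finally show ?thesis
      unfolding eq using ir S by simp
  qed
  show "integrable M (\<lambda>\<omega>. \<xi> \<omega> * (I T \<omega> - I s \<omega>))" using approx[of 1] by simp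
  let ?c = "\<bar>LINT \<omega>|M. \<xi> \<omega> * (I T \<omega> - I s \<omega>)\<bar>" and ?k = "LINT \<omega>|M. (\<xi> \<omega>)\<^sup>2"
  have "((\<lambda>e. e * ?k + e) \<longlongrightarrow> 0 * ?k + 0) (at_right 0)"
    by (intro tendsto_intros)
  moreover have "eventually (\<lambda>e. ?c \<le> e * ?k + e) (at_right 0)"
    using approx by (auto simp: eventually_at_right_less eventually_at_filter)
  ultimately have "?c \<le> 0 * ?k + 0"
    by (rule tendsto_lowerbound) simp
  then show "(LINT \<omega>|M. \<xi> \<omega> * (I T \<omega> - I s \<omega>)) = 0" by simp
qed

section \<open>Closure properties of progressive processes\<close>

lemma progressive_iff:
  "progressive M T W V \<longleftrightarrow> (\<forall>t\<in>{0..T}. (\<lambda>p. V (fst p) (snd p)) \<in>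
     borel_measurable (restrict_space borel {0..t} \<Otimes>\<^sub>M augmented_filtration M W t))"
  by (simp add: progressive_def case_prod_beta')

lemma progressive_add:
  "progressive M T W U \<Longrightarrow> progressive M T W V \<Longrightarrow> progressive M T W (\<lambda>s \<omega>. U s \<omega> + V s \<omega>)"
  unfolding progressive_iff by (intro ballI borel_measurable_add) auto

lemma progressive_diff:
  "progressive M T W U \<Longrightarrow> progressive M T W V \<Longrightarrow> progressive M T W (\<lambda>s \<omega>. U s \<omega> - V s \<omega>)"
  unfolding progressive_iff by (intro ballI borel_measurable_diff) auto

lemma progressive_mult:
  "progressive M T W U \<Longrightarrow> progressive M T W V \<Longrightarrow> progressive M T W (\<lambda>s \<omega>. U s \<omega> * V s \<omega>)"
  unfolding progressive_iff by (intro ballI borel_measurable_times) auto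

text \<open>Coefficients are measurable on \<open>{0..T}\<close>, whereas progressive measurability
  is tested on each strip \<open>{0..t}\<close>; this projection connects the two.\<close>

lemma measurable_fst_Icc:
  assumes "t \<in> {0..T}"
  shows "fst \<in> restrict_space borel {0..t} \<Otimes>\<^sub>M N \<rightarrow>\<^sub>M restrict_space borel {0..T::real}"
proof (rule measurable_restrict_space2)
  show "fst \<in> space (restrict_space borel {0..t} \<Otimes>\<^sub>M N) \<rightarrow> {0..T}"
    using assms by (auto simp: space_pair_measure)
  show "fst \<in> restrict_space borel {0..t} \<Otimes>\<^sub>M N \<rightarrow>\<^sub>M borel"
    by (rule measurable_compose[OF measurable_fst measurable_restrict_space1[OF measurable_ident_sets[OF refl]]])
qed

lemma progressive_deterministic:
  assumes "c \<in> borel_measurable (restrict_space borel {0..T})"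
  shows "progressive M T W (\<lambda>s \<omega>. c s)"
  unfolding progressive_iff using measurable_compose[OF measurable_fst_Icc assms] by blast

section \<open>The Hamiltonian\<close>

lemma space_P2_algebra [simp]: "space P2_algebra = P2"
  by (auto simp: P2_algebra_def space_restrict_space P2_def)

text \<open>The time argument \<open>\<tau>\<close> is a function on \<open>N\<close> so that
  \<open>N\<close> may be the product of a strip with the filtration and \<open>\<tau>\<close> its
  first projection.\<close>

lemma measurable_coeff_compose:
  assumes "measurable_coeff T A h" "\<tau> \<in> N \<rightarrow>\<^sub>M restrict_space borel {0..T}"
    and "x \<in> borel_measurable N" "m \<in> N \<rightarrow>\<^sub>M P2_algebra"
    and "a \<in> borel_measurable N" "\<And>w. w \<in> space N \<Longrightarrow> a w \<in> A"
  shows "(\<lambda>w. h (\<tau> w) (x w) (m w) (a w)) \<in> borel_measurable N"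
proof -
  have "(\<lambda>w. (\<tau> w, x w, m w, a w)) \<in>
      N \<rightarrow>\<^sub>M restrict_space borel {0..T} \<Otimes>\<^sub>M borel \<Otimes>\<^sub>M P2_algebra \<Otimes>\<^sub>M restrict_space borel A"
    by (intro measurable_Pair assms(2-4) measurable_restrict_space2[OF _ assms(5)]) (use assms(6) in auto)
  from measurable_compose[OF this assms(1)[unfolded measurable_coeff_def]] show ?thesis by simp
qed

text \<open>The functions \<open>b0\<close>, \<open>b1\<close>, \<open>b2\<close> and the bounds are
  existentially quantified in the standing assumptions; as parameters they are chosen once and
  shared by all lemmas.\<close>

locale control_problem =
  fixes T lam :: real and A :: "real set" and b f :: coeff and g :: "real \<Rightarrow> real measure \<Rightarrow> real"
    and \<mu> :: "real \<Rightarrow> real measure" and b0 :: "real \<Rightarrow> real measure \<Rightarrow> real" and b1 b2 :: "real \<Rightarrow> real"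
    and B1 B2 Cf Cg :: real
  assumes T_pos: "0 < T" and lam_pos: "0 < lam"
    and A: "compact A" "convex A" "A \<noteq> {}"
    and b_meas: "measurable_coeff T A b"
    and b_eq: "\<And>t x \<nu> a. t \<in> {0..T} \<Longrightarrow> \<nu> \<in> P2 \<Longrightarrow> a \<in> A \<Longrightarrow> b t x \<nu> a = b0 t \<nu> + b1 t * x + b2 t * a"
    and b1: "b1 \<in> borel_measurable (restrict_space borel {0..T})" "\<And>t. t \<in> {0..T} \<Longrightarrow> \<bar>b1 t\<bar> \<le> B1"
    and b2: "b2 \<in> borel_measurable (restrict_space borel {0..T})" "\<And>t. t \<in> {0..T} \<Longrightarrow> \<bar>b2 t\<bar> \<le> B2"
    and f: "running_cost_assumption T A lam f"
    and f_bound: "\<And>t x \<nu> a. t \<in> {0..T} \<Longrightarrow> \<nu> \<in> P2 \<Longrightarrow> a \<in> A \<Longrightarrow>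
      \<bar>f t x \<nu> a\<bar> \<le> Cf \<and> \<bar>partial_x f t x \<nu> a\<bar> \<le> Cf \<and> \<bar>partial_a A f t x \<nu> a\<bar> \<le> Cf"
    and g: "terminal_cost_assumption g"
    and g_bound: "\<And>x \<nu>. \<nu> \<in> P2 \<Longrightarrow> \<bar>g x \<nu>\<bar> \<le> Cg"
    and flow: "bounded_flow T \<mu>"
begin

lemma bounds_nonneg: "0 \<le> B1" "0 \<le> B2"
  using b1(2)[of 0] b2(2)[of 0] T_pos by auto

lemma f_meas: "measurable_coeff T A f"
  using f by (simp add: running_cost_assumption_def)

lemma flow_measurable: "\<mu> \<in> restrict_space borel {0..T} \<rightarrow>\<^sub>M P2_algebra"
  using flow by (simp add: bounded_flow_def)

lemma flow_P2: "t \<in> {0..T} \<Longrightarrow> \<mu> t \<in> P2"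
  using measurable_space[OF flow_measurable, of t] by simp

lemma f_convex:
  assumes "t \<in> {0..T}" "\<nu> \<in> P2" "a \<in> A" "a' \<in> A"
  shows "lam * \<bar>a' - a\<bar>\<^sup>2 \<le> f t x' \<nu> a' - f t x \<nu> a - (x' - x) * partial_x f t x \<nu> a
          - (a' - a) * partial_a A f t x \<nu> a"
  using f assms unfolding running_cost_assumption_def by blast

text \<open>Chain rule along \<open>z \<mapsto> (z, a)\<close>: the whole line lies in
  \<open>UNIV \<times> A\<close>, so the derivative relative to that set becomes an ordinary one in
  \<open>x\<close>.\<close>

lemma f_partial_x:
  assumes "t \<in> {0..T}" "\<nu> \<in> P2" "a \<in> A"
  shows "((\<lambda>x. f t x \<nu> a) has_real_derivative partial_x f t x \<nu> a) (at x)"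
proof -
  have F: "((\<lambda>(x, a). f t x \<nu> a) has_derivative
            (\<lambda>(u, v). partial_x f t x \<nu> a * u + partial_a A f t x \<nu> a * v))
            (at (x, a) within UNIV \<times> A)"
    using f assms unfolding running_cost_assumption_def by blast
  have "((\<lambda>z. (z, a)) has_derivative (\<lambda>u. (u, 0))) (at x)"
    by (intro derivative_eq_intros) auto
  from has_derivative_in_compose[OF this has_derivative_subset[OF F, of "range (\<lambda>z. (z, a))"]] assms
  have "((\<lambda>x. f t x \<nu> a) has_derivative (\<lambda>u. partial_x f t x \<nu> a * u)) (at x)"
    by auto
  then show ?thesis by (simp add: has_field_derivative_def)
qed

text \<open>The growth condition bounds \<open>f\<close> from below by its tangents. Applied with
  each of the two points as base point, it turns the bound \<open>Cf\<close> on the derivative in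
  \<open>a\<close> into a Lipschitz constant.\<close>

lemma f_continuous:
  assumes "t \<in> {0..T}" "\<nu> \<in> P2"
  shows "continuous_on A (\<lambda>a. f t x \<nu> a)"
proof -
  have *: "f t x \<nu> a - f t x \<nu> a' \<le> Cf * \<bar>a - a'\<bar>" if "a \<in> A" "a' \<in> A" for a a'
  proof -
    have "0 \<le> lam * \<bar>a' - a\<bar>\<^sup>2" using lam_pos by simp
    then have "f t x \<nu> a - f t x \<nu> a' \<le> (a - a') * partial_a A f t x \<nu> a"
      using f_convex[OF assms that, of x x] by (simp add: algebra_simps)
    also have "\<dots> \<le> \<bar>a - a'\<bar> * \<bar>partial_a A f t x \<nu> a\<bar>"
      by (metis abs_ge_self abs_mult)
    also have "\<dots> \<le> \<bar>a - a'\<bar> * Cf"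
      using f_bound[OF assms that(1)] by (intro mult_left_mono) auto
    finally show ?thesis by (simp add: mult.commute)
  qed
  have "Cf-lipschitz_on A (\<lambda>a. f t x \<nu> a)"
  proof (rule lipschitz_onI)
    show "dist (f t x \<nu> a) (f t x \<nu> a') \<le> Cf * dist a a'" if "a \<in> A" "a' \<in> A" for a a'
      using *[OF that] *[OF that(2,1)] by (simp add: dist_real_def abs_le_iff abs_minus_commute)
    show "0 \<le> Cf" using f_bound[OF assms] A(3) by fastforce
  qed
  then show ?thesis by (rule lipschitz_on_continuous_on)
qed

lemma hamiltonian_eq:
  "t \<in> {0..T} \<Longrightarrow> \<nu> \<in> P2 \<Longrightarrow> a \<in> A \<Longrightarrow>
    hamiltonian b f t x \<nu> y a = (b0 t \<nu> + b1 t * x + b2 t * a) * y + f t x \<nu> a"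
  by (simp add: hamiltonian_def b_eq)

lemma hamiltonian_continuous:
  assumes "t \<in> {0..T}" "\<nu> \<in> P2"
  shows "continuous_on A (\<lambda>a. hamiltonian b f t x \<nu> y a)"
proof -
  have "continuous_on A (\<lambda>a. (b0 t \<nu> + b1 t * x + b2 t * a) * y + f t x \<nu> a)"
    using f_continuous[OF assms] by (intro continuous_intros)
  then show ?thesis
    using hamiltonian_eq[OF assms] by (simp cong: continuous_on_cong_simp)
qed

lemma hamiltonian_x_eq:
  assumes "t \<in> {0..T}" "\<nu> \<in> P2" "a \<in> A"
  shows "hamiltonian_x b f t x \<nu> y a = b1 t * y + partial_x f t x \<nu> a"
proof -
  have "((\<lambda>x. (b0 t \<nu> + b1 t * x + b2 t * a) * y + f t x \<nu> a) has_real_derivative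
      b1 t * y + partial_x f t x \<nu> a) (at x)"
    using f_partial_x[OF assms] by (auto intro!: derivative_eq_intros)
  then show ?thesis
    unfolding hamiltonian_x_def hamiltonian_eq[OF assms] by (rule DERIV_imp_deriv)
qed

lemma hamiltonian_minimizer:
  assumes "t \<in> {0..T}" "\<nu> \<in> P2"
  shows "hamiltonian_minimizer A b f t x \<nu> y \<in> A"
    and "\<And>a. a \<in> A \<Longrightarrow>
      hamiltonian b f t x \<nu> y (hamiltonian_minimizer A b f t x \<nu> y) \<le> hamiltonian b f t x \<nu> y a"
  unfolding hamiltonian_minimizer_def
  using arg_min_on_compact[OF A(1,3) hamiltonian_continuous[OF assms]] by auto

text \<open>
  First-order condition at a minimizer: convexity at the intermediate points \<open>m + e * (a - m)\<close>
  together with the Lipschitz bound on the \<open>a\<close>-derivative, as \<open>e\<close> tends to \<open>0\<close>.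
\<close>
lemma variational_inequality:
  assumes t: "t \<in> {0..T}" "\<nu> \<in> P2" and m: "m \<in> A"
    and min: "\<And>a. a \<in> A \<Longrightarrow> hamiltonian b f t x \<nu> y m \<le> hamiltonian b f t x \<nu> y a"
    and a: "a \<in> A"
  shows "0 \<le> (a - m) * (b2 t * y + partial_a A f t x \<nu> m)"
proof -
  obtain C where C: "C-lipschitz_on (UNIV \<times> A) (\<lambda>(x, a). partial_a A f t x \<nu> a)"
    using f t unfolding running_cost_assumption_def by blast
  let ?P = "\<lambda>a. partial_a A f t x \<nu> a"
  let ?G = "\<lambda>e. (a - m) * (b2 t * y + ?P m) + C * \<bar>a - m\<bar>\<^sup>2 * e"
  have "0 \<le> ?G e" if e: "0 < e" "e \<le> 1" for e
  proof -
    let ?c = "m + e * (a - m)"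
    have "?c = (1 - e) * m + e * a" by (simp add: algebra_simps)
    then have c: "?c \<in> A"
      using convexD[OF A(2) m a, of "1 - e" e] e by simp
    have "0 \<le> lam * \<bar>m - ?c\<bar>\<^sup>2" using lam_pos by simp
    \<comment> \<open>The base point is \<open>?c\<close> and not \<open>m\<close>: tangents bound
      \<open>f\<close> from below, so an upper bound for \<open>f\<close> at \<open>?c\<close> minus
      \<open>f\<close> at \<open>m\<close> involves the derivative at \<open>?c\<close>. The
      Lipschitz constant then moves it back to \<open>m\<close>.\<close>
    then have "(m - ?c) * ?P ?c \<le> f t x \<nu> m - f t x \<nu> ?c"
      using f_convex[OF t c m, of x x] by simp
    also have "\<dots> \<le> b2 t * (?c - m) * y"
      using min[OF c] unfolding hamiltonian_eq[OF t m] hamiltonian_eq[OF t c] by (simp add: algebra_simps)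
    finally have "0 \<le> e * ((a - m) * (b2 t * y + ?P ?c))" by (simp add: algebra_simps)
    then have "0 \<le> (a - m) * (b2 t * y + ?P ?c)" using e by (simp add: zero_le_mult_iff)
    also have "\<dots> = (a - m) * (b2 t * y + ?P m) + (a - m) * (?P ?c - ?P m)"
      by (simp add: algebra_simps)
    also have "\<dots> \<le> (a - m) * (b2 t * y + ?P m) + \<bar>a - m\<bar> * (C * (e * \<bar>a - m\<bar>))"
    proof (rule add_left_mono)
      have "\<bar>?P ?c - ?P m\<bar> \<le> C * (e * \<bar>a - m\<bar>)"
        using lipschitz_onD[OF C, of "(x, ?c)" "(x, m)"] c m e
        by (simp add: dist_Pair_Pair dist_real_def abs_mult)
      then have "\<bar>a - m\<bar> * \<bar>?P ?c - ?P m\<bar> \<le> \<bar>a - m\<bar> * (C * (e * \<bar>a - m\<bar>))"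
        by (rule mult_left_mono) simp
      then show "(a - m) * (?P ?c - ?P m) \<le> \<bar>a - m\<bar> * (C * (e * \<bar>a - m\<bar>))"
        by (metis abs_ge_self abs_mult order_trans)
    qed
    also have "\<dots> = ?G e" by (simp add: power2_eq_square algebra_simps)
    finally show ?thesis .
  qed
  then have "eventually (\<lambda>e. 0 \<le> ?G e) (at_right 0)"
    using eventually_at_right[of 0 "1::real"] by (auto intro!: exI[of _ 1])
  moreover have "(?G \<longlongrightarrow> (a - m) * (b2 t * y + ?P m) + C * \<bar>a - m\<bar>\<^sup>2 * 0) (at_right 0)"
    by (intro tendsto_intros)
  ultimately show ?thesis
    using tendsto_lowerbound[of ?G _ "at_right 0" 0] by simp
qed

text \<open>In the growth condition with base point \<open>(x, m)\<close>, the first-order condition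
  allows replacing the derivative of \<open>f\<close> in \<open>a\<close> by
  \<open>- b2 t * y\<close>.\<close>

lemma running_cost_growth:
  assumes t: "t \<in> {0..T}" "\<nu> \<in> P2" and m: "m \<in> A"
    and min: "\<And>a. a \<in> A \<Longrightarrow> hamiltonian b f t x \<nu> y m \<le> hamiltonian b f t x \<nu> y a"
    and a: "a \<in> A"
  shows "f t x \<nu> m + lam * \<bar>a - m\<bar>\<^sup>2 + (x' - x) * partial_x f t x \<nu> m - b2 t * (a - m) * y \<le> f t x' \<nu> a"
  using f_convex[OF t m a, of x' x] variational_inequality[OF assms] by (simp add: algebra_simps)

text \<open>With the state frozen, \<open>x' = x\<close>, the growth estimate says that the
  Hamiltonian at \<open>p\<close> exceeds its minimum by at least \<open>lam\<close> times the
  squared distance of \<open>p\<close> to the minimizer.\<close>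

lemma hamiltonian_minimizer_unique:
  assumes t: "t \<in> {0..T}" "\<nu> \<in> P2" and p: "p \<in> A"
    and le: "hamiltonian b f t x \<nu> y p \<le> hamiltonian b f t x \<nu> y (hamiltonian_minimizer A b f t x \<nu> y)"
  shows "p = hamiltonian_minimizer A b f t x \<nu> y"
proof -
  let ?m = "hamiltonian_minimizer A b f t x \<nu> y"
  note m = hamiltonian_minimizer[OF t, where x = x and y = y]
  have "lam * \<bar>p - ?m\<bar>\<^sup>2 \<le> 0"
    using running_cost_growth[OF t m p, of x] le
    unfolding hamiltonian_eq[OF t p] hamiltonian_eq[OF t m(1)] by (simp add: algebra_simps)
  then show ?thesis using lam_pos by (simp add: mult_le_0_iff)
qed

section \<open>Measurability of the feedback and of the derivative in the state\<close>

lemma hamiltonian_minimizer_measurable: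
  assumes \<tau>: "\<tau> \<in> N \<rightarrow>\<^sub>M restrict_space borel {0..T}"
    and x: "x \<in> borel_measurable N" and y: "y \<in> borel_measurable N"
  shows "(\<lambda>w. hamiltonian_minimizer A b f (\<tau> w) (x w) (\<mu> (\<tau> w)) (y w)) \<in> borel_measurable N"
  unfolding hamiltonian_minimizer_def
proof (rule borel_measurable_arg_min_on[OF A(1,3)])
  have \<tau>T: "\<tau> w \<in> {0..T}" "\<mu> (\<tau> w) \<in> P2" if "w \<in> space N" for w
    using measurable_space[OF \<tau> that] flow_P2 by auto
  show "continuous_on A (hamiltonian b f (\<tau> w) (x w) (\<mu> (\<tau> w)) (y w))" if "w \<in> space N" for w
    using hamiltonian_continuous[OF \<tau>T[OF that]] by simp
  show "p = arg_min_on (hamiltonian b f (\<tau> w) (x w) (\<mu> (\<tau> w)) (y w)) A"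
    if "w \<in> space N" "p \<in> A" "hamiltonian b f (\<tau> w) (x w) (\<mu> (\<tau> w)) (y w) p \<le>
      hamiltonian b f (\<tau> w) (x w) (\<mu> (\<tau> w)) (y w)
        (arg_min_on (hamiltonian b f (\<tau> w) (x w) (\<mu> (\<tau> w)) (y w)) A)" for w p
    using hamiltonian_minimizer_unique[OF \<tau>T[OF that(1)] that(2), of "x w" "y w"] that(3)
    by (simp add: hamiltonian_minimizer_def)
  show "(\<lambda>w. hamiltonian b f (\<tau> w) (x w) (\<mu> (\<tau> w)) (y w) a) \<in> borel_measurable N" if "a \<in> A" for a
    unfolding hamiltonian_def
    by (intro borel_measurable_add borel_measurable_times y
        measurable_coeff_compose[OF b_meas \<tau> x] measurable_coeff_compose[OF f_meas \<tau> x]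
        measurable_compose[OF \<tau> flow_measurable] borel_measurable_const that)
qed

text \<open>The measurability assumption concerns \<open>f\<close> itself; its derivative inherits
  it as a limit of difference quotients along the nonzero steps
  \<open>1 / real (Suc n)\<close>.\<close>

lemma partial_x_measurable:
  assumes \<tau>: "\<tau> \<in> N \<rightarrow>\<^sub>M restrict_space borel {0..T}"
    and x: "x \<in> borel_measurable N" and a: "a \<in> borel_measurable N" "\<And>w. w \<in> space N \<Longrightarrow> a w \<in> A"
  shows "(\<lambda>w. partial_x f (\<tau> w) (x w) (\<mu> (\<tau> w)) (a w)) \<in> borel_measurable N"
proof (rule borel_measurable_LIMSEQ_real)
  let ?q = "\<lambda>n w. (f (\<tau> w) (x w + 1 / real (Suc n)) (\<mu> (\<tau> w)) (a w) - f (\<tau> w) (x w) (\<mu> (\<tau> w)) (a w)) /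
      (1 / real (Suc n))"
  show "?q n \<in> borel_measurable N" for n
    by (intro borel_measurable_divide borel_measurable_diff borel_measurable_const borel_measurable_add x a
        measurable_coeff_compose[OF f_meas \<tau>] measurable_compose[OF \<tau> flow_measurable])
  fix w assume w: "w \<in> space N"
  have t: "\<tau> w \<in> {0..T}" "\<mu> (\<tau> w) \<in> P2"
    using measurable_space[OF \<tau> w] flow_P2 by auto
  have "((\<lambda>h. (f (\<tau> w) (x w + h) (\<mu> (\<tau> w)) (a w) - f (\<tau> w) (x w) (\<mu> (\<tau> w)) (a w)) / h)
      \<longlongrightarrow> partial_x f (\<tau> w) (x w) (\<mu> (\<tau> w)) (a w)) (at 0)"
    using f_partial_x[OF t a(2)[OF w], of "x w"] by (simp add: DERIV_def)
  moreover have "filterlim (\<lambda>n. 1 / real (Suc n)) (at 0) sequentially"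
    unfolding filterlim_at using LIMSEQ_Suc[OF lim_1_over_n] by simp
  ultimately show "(\<lambda>n. ?q n w) \<longlonglongrightarrow> partial_x f (\<tau> w) (x w) (\<mu> (\<tau> w)) (a w)"
    by (rule filterlim_compose)
qed

lemma terminal_cost_tangent:
  assumes "\<nu> \<in> P2"
  shows "deriv (\<lambda>x. g x \<nu>) x * (x' - x) \<le> g x' \<nu> - g x \<nu>"
proof -
  have "convex_on UNIV (\<lambda>x. g x \<nu>)" "(\<lambda>x. g x \<nu>) C1_differentiable_on UNIV"
    using g assms by (auto simp: terminal_cost_assumption_def)
  moreover from this(2) have "((\<lambda>x. g x \<nu>) has_real_derivative deriv (\<lambda>x. g x \<nu>) x) (at x)"
    using DERIV_deriv_iff_real_differentiable
    by (metis C1_differentiable_on_eq UNIV_I)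
  ultimately show ?thesis
    by (intro convex_on_imp_above_tangent[where A = UNIV]) auto
qed

lemma progressive_coeff:
  assumes k: "measurable_coeff T A k" and V: "progressive M T W V" and u: "progressive M T W u"
    and uA: "\<And>t \<omega>. t \<in> {0..T} \<Longrightarrow> \<omega> \<in> space M \<Longrightarrow> u t \<omega> \<in> A"
  shows "progressive M T W (\<lambda>s \<omega>. k s (V s \<omega>) (\<mu> s) (u s \<omega>))"
  unfolding progressive_iff
proof
  fix t assume t: "t \<in> {0..T}"
  note fst = measurable_fst_Icc[OF t]
  show "(\<lambda>p. k (fst p) (V (fst p) (snd p)) (\<mu> (fst p)) (u (fst p) (snd p)))
      \<in> borel_measurable (restrict_space borel {0..t} \<Otimes>\<^sub>M augmented_filtration M W t)"
    by (rule measurable_coeff_compose[OF k fst _ measurable_compose[OF fst flow_measurable]])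
      (use V u uA t in \<open>auto simp: progressive_iff space_pair_measure\<close>)
qed

lemma progressive_minimizer:
  assumes V: "progressive M T W V" and Y: "progressive M T W Y"
  shows "progressive M T W (\<lambda>s \<omega>. hamiltonian_minimizer A b f s (V s \<omega>) (\<mu> s) (Y s \<omega>))"
  unfolding progressive_iff
proof
  fix t assume t: "t \<in> {0..T}"
  show "(\<lambda>p. hamiltonian_minimizer A b f (fst p) (V (fst p) (snd p)) (\<mu> (fst p)) (Y (fst p) (snd p)))
      \<in> borel_measurable (restrict_space borel {0..t} \<Otimes>\<^sub>M augmented_filtration M W t)"
    by (rule hamiltonian_minimizer_measurable[OF measurable_fst_Icc[OF t]])
      (use V Y t in \<open>auto simp: progressive_iff\<close>)
qed

lemma progressive_partial_x:
  assumes V: "progressive M T W V" and u: "progressive M T W u"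
    and uA: "\<And>t \<omega>. t \<in> {0..T} \<Longrightarrow> \<omega> \<in> space M \<Longrightarrow> u t \<omega> \<in> A"
  shows "progressive M T W (\<lambda>s \<omega>. partial_x f s (V s \<omega>) (\<mu> s) (u s \<omega>))"
  unfolding progressive_iff
proof
  fix t assume t: "t \<in> {0..T}"
  show "(\<lambda>p. partial_x f (fst p) (V (fst p) (snd p)) (\<mu> (fst p)) (u (fst p) (snd p)))
      \<in> borel_measurable (restrict_space borel {0..t} \<Otimes>\<^sub>M augmented_filtration M W t)"
    by (rule partial_x_measurable[OF measurable_fst_Icc[OF t]])
      (use V u uA t in \<open>auto simp: progressive_iff space_pair_measure\<close>)
qed

end

section \<open>Comparison of two controls\<close>

text \<open>The moment hypothesis enters through \<open>S\<close>, a bound on the second moments of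
  \<open>Y\<close> uniform in time. As an \<open>ennreal\<close> it can be instantiated with the
  moment integral itself.\<close>

locale controlled_comparison = control_problem T lam A b f g \<mu> b0 b1 b2 B1 B2 Cf Cg
  for T lam A b f g \<mu> b0 b1 b2 B1 B2 Cf Cg +
  fixes M :: "'a measure" and W :: "real \<Rightarrow> 'a \<Rightarrow> real" and \<sigma> :: real and x0 :: "'a \<Rightarrow> real"
    and X Y Z I ahat a Xa :: "real \<Rightarrow> 'a \<Rightarrow> real" and S :: ennreal
  assumes W: "brownian_motion M T W"
    and ahat: "\<And>t \<omega>. ahat t \<omega> = hamiltonian_minimizer A b f t (X t \<omega>) (\<mu> t) (Y t \<omega>)"
    and X: "state_process M T W \<sigma> x0 b \<mu> ahat X"
    and Y: "continuous_progressive M T W Y"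
    and I: "ito_integral M T W Z I"
    and backward: "AE \<omega> in M.
          set_integrable lborel {0..T} (\<lambda>s. hamiltonian_x b f s (X s \<omega>) (\<mu> s) (Y s \<omega>) (ahat s \<omega>)) \<and>
          (\<forall>t\<in>{0..T}. Y t \<omega> = Y 0 \<omega>
            - (LBINT s:{0..t}. hamiltonian_x b f s (X s \<omega>) (\<mu> s) (Y s \<omega>) (ahat s \<omega>)) + I t \<omega>) \<and>
          Y T \<omega> = deriv (\<lambda>x. g x (\<mu> T)) (X T \<omega>)"
    and Y_square: "S < \<infinity>" "\<And>t. t \<in> {0..T} \<Longrightarrow> (\<integral>\<^sup>+\<omega>. ennreal ((Y t \<omega>)\<^sup>2) \<partial>M) \<le> S"
    and a: "admissible M T W A a"
    and Xa: "state_process M T W \<sigma> x0 b \<mu> a Xa"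
begin

sublocale prob_space M
  using W by (simp add: brownian_motion_def)

abbreviation "\<Lambda> \<equiv> restrict_space lborel {0..T}"

lemma finite_measure_time: "finite_measure \<Lambda>"
  by (rule finite_measureI) (use T_pos in \<open>simp add: emeasure_restrict_space space_restrict_space\<close>)

text \<open>Time is the first factor, so facts about the second projection integrate out time along
  a fixed path.\<close>

sublocale pair_sigma_finite \<Lambda> M
proof -
  interpret L: finite_measure \<Lambda> by (rule finite_measure_time)
  show "pair_sigma_finite \<Lambda> M" ..
qed

sublocale joint: finite_measure "\<Lambda> \<Otimes>\<^sub>M M"
  by (rule finite_measure_pair_measure[OF finite_measure_axioms finite_measure_time])

definition \<beta> :: "real \<Rightarrow> 'a \<Rightarrow> real" where
  "\<beta> s \<omega> = b1 s * (X s \<omega> - Xa s \<omega>) + b2 s * (ahat s \<omega> - a s \<omega>)"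

text \<open>A closed form from which progressive measurability and integrability can be read off;
  \<open>h_eq\<close> identifies it with \<open>hamiltonian_x\<close> at the times in
  \<open>{0..T}\<close>.\<close>

definition h :: "real \<Rightarrow> 'a \<Rightarrow> real" where
  "h s \<omega> = b1 s * Y s \<omega> + partial_x f s (X s \<omega>) (\<mu> s) (ahat s \<omega>)"

lemma T_in: "T \<in> {0..T}" "0 \<in> {0..T}"
  using T_pos by auto

lemma a_in: "t \<in> {0..T} \<Longrightarrow> \<omega> \<in> space M \<Longrightarrow> a t \<omega> \<in> A"
  using a by (simp add: admissible_def)

lemma ahat_in: "t \<in> {0..T} \<Longrightarrow> ahat t \<omega> \<in> A"
  unfolding ahat by (rule hamiltonian_minimizer(1)[OF _ flow_P2])

lemma progressive_processes:
  shows progressive_X: "progressive M T W X" and progressive_Xa: "progressive M T W Xa"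
    and progressive_Y: "progressive M T W Y" and progressive_I: "progressive M T W I"
    and progressive_a: "progressive M T W a"
  using X Xa Y I a
  by (simp_all add: state_process_def continuous_progressive_def ito_integral_def admissible_def)

lemma progressive_ahat: "progressive M T W ahat"
  using progressive_minimizer[OF progressive_X progressive_Y] by (simp add: ahat[abs_def])

lemma progressive_\<beta>: "progressive M T W \<beta>"
  unfolding \<beta>_def[abs_def]
  by (intro progressive_add progressive_mult progressive_diff progressive_deterministic b1 b2
      progressive_processes progressive_ahat)

lemma progressive_h: "progressive M T W h"
  unfolding h_def[abs_def]
  by (intro progressive_add progressive_mult progressive_deterministic b1
      progressive_processes progressive_partial_x progressive_ahat ahat_in)

lemmas joint_measurable = progressive_measurable[OF W less_imp_le[OF T_pos]]

lemma measurable_at: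
  "progressive M T W V \<Longrightarrow> t \<in> {0..T} \<Longrightarrow> V t \<in> borel_measurable M"
  using borel_measurable_augmented_filtration[OF W _ progressive_adapted[of M T W V t]] by simp

lemma h_eq:
  "s \<in> {0..T} \<Longrightarrow> hamiltonian_x b f s (X s \<omega>) (\<mu> s) (Y s \<omega>) (ahat s \<omega>) = h s \<omega>"
  by (simp add: h_def hamiltonian_x_eq flow_P2 ahat_in)

lemma integrable_joint_bounded:
  assumes "progressive M T W V" "\<And>s \<omega>. s \<in> {0..T} \<Longrightarrow> \<omega> \<in> space M \<Longrightarrow> \<bar>V s \<omega>\<bar> \<le> C"
  shows "integrable (\<Lambda> \<Otimes>\<^sub>M M) (\<lambda>(s, \<omega>). V s \<omega>)"
  by (rule joint.integrable_const_bound[of _ C, OF AE_I2 joint_measurable[OF assms(1)]])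
    (use assms(2) in \<open>auto simp: space_pair_measure\<close>)

lemma integrable_joint_snd:
  fixes q :: "'a \<Rightarrow> real"
  assumes q: "integrable M q"
  shows "integrable (\<Lambda> \<Otimes>\<^sub>M M) (\<lambda>(s, \<omega>). q \<omega>)"
proof (rule Fubini_integrable)
  interpret L: finite_measure \<Lambda> by (rule finite_measure_time)
  show "(\<lambda>(s, \<omega>). q \<omega>) \<in> borel_measurable (\<Lambda> \<Otimes>\<^sub>M M)"
    using measurable_compose[OF measurable_snd borel_measurable_integrable[OF q]]
    by (simp add: case_prod_beta')
  show "integrable \<Lambda> (\<lambda>s. \<integral>\<omega>. norm (case (s, \<omega>) of (s, \<omega>) \<Rightarrow> q \<omega>) \<partial>M)"
    by simp
  show "AE s in \<Lambda>. integrable M (\<lambda>\<omega>. case (s, \<omega>) of (s, \<omega>) \<Rightarrow> q \<omega>)"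
    using q by simp
qed

text \<open>It matters that \<open>C\<close> does not depend on the scenario: this makes
  \<open>\<beta> s\<close> square integrable and lets \<open>K\<close> be dominated by integrable
  terms.\<close>

lemma state_difference:
  obtains C where "0 \<le> C" "AE \<omega> in M. set_integrable lborel {0..T} (\<lambda>s. \<beta> s \<omega>) \<and>
    (\<forall>t\<in>{0..T}. X t \<omega> - Xa t \<omega> = (LBINT s:{0..t}. \<beta> s \<omega>)) \<and> (\<forall>s\<in>{0..T}. \<bar>\<beta> s \<omega>\<bar> \<le> C)"
proof -
  obtain R where R: "\<And>x. x \<in> A \<Longrightarrow> \<bar>x\<bar> \<le> R"
    using compact_imp_bounded[OF A(1)] by (auto simp: bounded_iff)
  obtain x where "x \<in> A" using A(3) by auto
  then have R0: "0 \<le> R" using R by fastforce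
  \<comment> \<open>\<open>c\<close> bounds the control part of \<open>\<beta>\<close>, as both
    controls have modulus at most \<open>R\<close>. \<open>C\<close> inserts the Gronwall bound on
    \<open>X - Xa\<close> into the state part.\<close>
  define c where "c = B2 * (2 * R)"
  define C where "C = B1 * (2 * c * T * exp ((2 * B1 + 1) * T)) + c"
  have c0: "0 \<le> c" using R0 bounds_nonneg by (simp add: c_def)
  have C0: "0 \<le> C" using c0 bounds_nonneg T_pos by (simp add: C_def)
  have "AE \<omega> in M. set_integrable lborel {0..T} (\<lambda>s. b s (X s \<omega>) (\<mu> s) (ahat s \<omega>)) \<and>
      (\<forall>t\<in>{0..T}. X t \<omega> = x0 \<omega> + (LBINT s:{0..t}. b s (X s \<omega>) (\<mu> s) (ahat s \<omega>)) + \<sigma> * W t \<omega>)"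
    and "AE \<omega> in M. set_integrable lborel {0..T} (\<lambda>s. b s (Xa s \<omega>) (\<mu> s) (a s \<omega>)) \<and>
      (\<forall>t\<in>{0..T}. Xa t \<omega> = x0 \<omega> + (LBINT s:{0..t}. b s (Xa s \<omega>) (\<mu> s) (a s \<omega>)) + \<sigma> * W t \<omega>)"
    and "AE \<omega> in M. continuous_on {0..T} (\<lambda>t. X t \<omega>)" "AE \<omega> in M. continuous_on {0..T} (\<lambda>t. Xa t \<omega>)"
    using X Xa unfolding state_process_def continuous_progressive_def by blast+
  with AE_space have "AE \<omega> in M. set_integrable lborel {0..T} (\<lambda>s. \<beta> s \<omega>) \<and>
    (\<forall>t\<in>{0..T}. X t \<omega> - Xa t \<omega> = (LBINT s:{0..t}. \<beta> s \<omega>)) \<and> (\<forall>s\<in>{0..T}. \<bar>\<beta> s \<omega>\<bar> \<le> C)"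
  proof eventually_elim
    case (elim \<omega>)
    let ?b = "\<lambda>s. b s (X s \<omega>) (\<mu> s) (ahat s \<omega>)" and ?ba = "\<lambda>s. b s (Xa s \<omega>) (\<mu> s) (a s \<omega>)"
    have beq: "?b s - ?ba s = \<beta> s \<omega>" if "s \<in> {0..T}" for s
      using b_eq[OF that flow_P2[OF that]] ahat_in[OF that] a_in[OF that elim(1)]
      by (simp add: \<beta>_def algebra_simps)
    have bi: "set_integrable lborel {0..T} ?b" and bai: "set_integrable lborel {0..T} ?ba"
      using elim by blast+
    have int: "set_integrable lborel {0..T} (\<lambda>s. \<beta> s \<omega>)"
      by (rule iffD1[OF set_integrable_cong[OF refl refl beq] set_integral_diff(1)[OF bi bai]])
    have D: "X t \<omega> - Xa t \<omega> = (LBINT s:{0..t}. \<beta> s \<omega>)" if t: "t \<in> {0..T}" for t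
    proof -
      have sub: "set_integrable lborel {0..t} ?b" "set_integrable lborel {0..t} ?ba"
        using t by (auto intro: set_integrable_subset[OF bi] set_integrable_subset[OF bai])
      have "X t \<omega> - Xa t \<omega> = (LBINT s:{0..t}. ?b s) - (LBINT s:{0..t}. ?ba s)"
        using elim(2,3) t by simp
      also have "\<dots> = (LBINT s:{0..t}. ?b s - ?ba s)"
        using set_integral_diff(2)[OF sub] by simp
      also have "\<dots> = (LBINT s:{0..t}. \<beta> s \<omega>)"
        by (rule set_lebesgue_integral_cong) (use beq t in auto)
      finally show ?thesis .
    qed
    have \<beta>: "\<bar>\<beta> s \<omega>\<bar> \<le> B1 * \<bar>X s \<omega> - Xa s \<omega>\<bar> + c" if s: "s \<in> {0..T}" for s
    proof -
      have "\<bar>\<beta> s \<omega>\<bar> \<le> \<bar>b1 s\<bar> * \<bar>X s \<omega> - Xa s \<omega>\<bar> + \<bar>b2 s\<bar> * \<bar>ahat s \<omega> - a s \<omega>\<bar>"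
        unfolding \<beta>_def by (metis abs_mult abs_triangle_ineq)
      also have "\<dots> \<le> B1 * \<bar>X s \<omega> - Xa s \<omega>\<bar> + B2 * (2 * R)"
      proof (intro add_mono mult_mono)
        show "\<bar>ahat s \<omega> - a s \<omega>\<bar> \<le> 2 * R"
          using R[OF ahat_in[OF s, of \<omega>]] R[OF a_in[OF s elim(1)]] by linarith
      qed (use b1(2)[OF s] b2(2)[OF s] bounds_nonneg in auto)
      finally show ?thesis by (simp add: c_def)
    qed
    have "continuous_on {0..T} (\<lambda>t. X t \<omega> - Xa t \<omega>)"
      using elim(4,5) by (rule continuous_on_diff)
    from gronwall_bound[OF _ _ c0 this int D \<beta>] T_pos bounds_nonneg
    have bound: "\<bar>X s \<omega> - Xa s \<omega>\<bar> \<le> 2 * c * T * exp ((2 * B1 + 1) * T)" if "s \<in> {0..T}" for s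
      using that by auto
    have "\<bar>\<beta> s \<omega>\<bar> \<le> C" if "s \<in> {0..T}" for s
      using \<beta>[OF that] mult_left_mono[OF bound[OF that] bounds_nonneg(1)] by (simp add: C_def)
    with int D show ?case by blast
  qed
  with C0 show thesis by (rule that)
qed

section \<open>Integrability on the product of time and scenarios\<close>

lemma integrable_Y:
  shows integrable_Y_at: "t \<in> {0..T} \<Longrightarrow> integrable M (Y t)"
    and integrable_Y_joint: "integrable (\<Lambda> \<Otimes>\<^sub>M M) (\<lambda>(s, \<omega>). Y s \<omega>)"
proof -
  interpret L: finite_measure \<Lambda> by (rule finite_measure_time)
  have [measurable]: "(\<lambda>(s, \<omega>). Y s \<omega>) \<in> borel_measurable (\<Lambda> \<Otimes>\<^sub>M M)"
    by (rule joint_measurable[OF progressive_Y])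
  show "integrable M (Y t)" if t: "t \<in> {0..T}" for t
  proof (rule square_integrable_imp_integrable)
    show "Y t \<in> borel_measurable M" by (rule measurable_at[OF progressive_Y t])
    then show "integrable M (\<lambda>\<omega>. (Y t \<omega>)\<^sup>2)"
      using Y_square(2)[OF t] Y_square(1) by (intro integrableI_nonneg) auto
  qed
  show "integrable (\<Lambda> \<Otimes>\<^sub>M M) (\<lambda>(s, \<omega>). Y s \<omega>)"
  proof (rule joint.square_integrable_imp_integrable)
    have m: "(\<lambda>p. ennreal ((case p of (s, \<omega>) \<Rightarrow> Y s \<omega>)\<^sup>2)) \<in> borel_measurable (\<Lambda> \<Otimes>\<^sub>M M)"
      by measurable
    have "(\<integral>\<^sup>+p. ennreal ((case p of (s, \<omega>) \<Rightarrow> Y s \<omega>)\<^sup>2) \<partial>(\<Lambda> \<Otimes>\<^sub>M M)) =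
        (\<integral>\<^sup>+s. \<integral>\<^sup>+\<omega>. ennreal ((Y s \<omega>)\<^sup>2) \<partial>M \<partial>\<Lambda>)"
      using sigma_finite_measure.nn_integral_fst[OF prob_space_imp_sigma_finite[OF prob_space_axioms] m] by simp
    also have "\<dots> \<le> (\<integral>\<^sup>+s. S \<partial>\<Lambda>)"
      by (rule nn_integral_mono) (use Y_square(2) in \<open>auto simp: space_restrict_space\<close>)
    also have "\<dots> < \<infinity>"
      using Y_square(1) L.emeasure_finite[of "space \<Lambda>"] unfolding less_top
      by (simp add: ennreal_mult_less_top)
    finally show "integrable (\<Lambda> \<Otimes>\<^sub>M M) (\<lambda>p. (case p of (s, \<omega>) \<Rightarrow> Y s \<omega>)\<^sup>2)"
      by (intro integrableI_nonneg) auto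
  qed auto
qed

lemma integrable_h: "integrable (\<Lambda> \<Otimes>\<^sub>M M) (\<lambda>(s, \<omega>). h s \<omega>)"
proof (rule Bochner_Integration.integrable_bound)
  show "integrable (\<Lambda> \<Otimes>\<^sub>M M) (\<lambda>p. B1 * \<bar>case p of (s, \<omega>) \<Rightarrow> Y s \<omega>\<bar> + Cf)"
    using integrable_Y_joint by auto
  show "AE p in \<Lambda> \<Otimes>\<^sub>M M. norm (case p of (s, \<omega>) \<Rightarrow> h s \<omega>) \<le> norm (B1 * \<bar>case p of (s, \<omega>) \<Rightarrow> Y s \<omega>\<bar> + Cf)"
  proof (rule AE_I2)
    fix p assume "p \<in> space (\<Lambda> \<Otimes>\<^sub>M M)"
    then obtain s \<omega> where p: "p = (s, \<omega>)" and s: "s \<in> {0..T}"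
      by (auto simp: space_pair_measure)
    have "\<bar>h s \<omega>\<bar> \<le> \<bar>b1 s\<bar> * \<bar>Y s \<omega>\<bar> + \<bar>partial_x f s (X s \<omega>) (\<mu> s) (ahat s \<omega>)\<bar>"
      unfolding h_def by (metis abs_mult abs_triangle_ineq)
    also have "\<dots> \<le> B1 * \<bar>Y s \<omega>\<bar> + Cf"
      using b1(2)[OF s] f_bound[OF s flow_P2[OF s] ahat_in[OF s]]
      by (intro add_mono mult_right_mono) auto
    finally show "norm (case p of (s, \<omega>) \<Rightarrow> h s \<omega>) \<le> norm (B1 * \<bar>case p of (s, \<omega>) \<Rightarrow> Y s \<omega>\<bar> + Cf)"
      by (simp add: p)
  qed
qed (rule joint_measurable[OF progressive_h])

definition K :: "real \<Rightarrow> 'a \<Rightarrow> real" where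
  "K s \<omega> = \<beta> s \<omega> * (I T \<omega> - I s \<omega>)"

text \<open>The backward equation expresses \<open>I t\<close> as \<open>Y t - Y 0\<close> plus the
  integral of \<open>h\<close> up to \<open>t\<close>; \<open>q\<close> collects what can be bounded
  uniformly in \<open>t\<close>. Neither the Ito isometry nor a maximal inequality enters.\<close>

lemma integral_bound:
  obtains q where "integrable M q" "AE \<omega> in M. \<forall>s\<in>{0..T}. \<bar>I s \<omega>\<bar> \<le> \<bar>Y s \<omega>\<bar> + q \<omega>"
proof
  let ?q = "\<lambda>\<omega>. \<bar>Y 0 \<omega>\<bar> + (\<integral>s. \<bar>h s \<omega>\<bar> \<partial>\<Lambda>)"
  have "integrable (\<Lambda> \<Otimes>\<^sub>M M) (\<lambda>(s, \<omega>). \<bar>h s \<omega>\<bar>)"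
    using integrable_abs[OF integrable_h] by (simp add: case_prod_beta')
  then show "integrable M ?q"
    using integrable_Y_at[OF T_in(2)] by (intro Bochner_Integration.integrable_add integrable_abs integrable_snd)
  show "AE \<omega> in M. \<forall>s\<in>{0..T}. \<bar>I s \<omega>\<bar> \<le> \<bar>Y s \<omega>\<bar> + ?q \<omega>"
    using backward
  proof eventually_elim
    case (elim \<omega>)
    let ?H = "\<lambda>s. hamiltonian_x b f s (X s \<omega>) (\<mu> s) (Y s \<omega>) (ahat s \<omega>)"
    have H: "set_integrable lborel {0..T} ?H" using elim by blast
    have hint: "set_integrable lborel {0..T} (\<lambda>s. h s \<omega>)"
      by (rule iffD1[OF set_integrable_cong[OF refl refl h_eq] H])
    show ?case
    proof
      fix t assume t: "t \<in> {0..T}"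
      have hint_t: "set_integrable lborel {0..t} (\<lambda>s. h s \<omega>)"
        using t by (auto intro: set_integrable_subset[OF hint])
      have "\<bar>LBINT s:{0..t}. ?H s\<bar> = \<bar>LBINT s:{0..t}. h s \<omega>\<bar>"
        using h_eq t by (intro arg_cong[where f = abs] set_lebesgue_integral_cong) auto
      also have "\<dots> \<le> (LBINT s:{0..t}. \<bar>h s \<omega>\<bar>)"
        using set_integral_norm_bound[OF hint_t] by simp
      also have "\<dots> \<le> (LBINT s:{0..T}. \<bar>h s \<omega>\<bar>)"
      proof -
        have habs: "set_integrable lborel {0..T} (\<lambda>s. \<bar>h s \<omega>\<bar>)" "set_integrable lborel {0..t} (\<lambda>s. \<bar>h s \<omega>\<bar>)"
          using set_integrable_norm[OF hint] set_integrable_norm[OF hint_t] by auto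
        show ?thesis
          unfolding set_lebesgue_integral_def
          by (rule integral_mono) (use habs t in \<open>auto simp: set_integrable_def indicator_def\<close>)
      qed
      finally have "\<bar>LBINT s:{0..t}. ?H s\<bar> \<le> (\<integral>s. \<bar>h s \<omega>\<bar> \<partial>\<Lambda>)"
        by (simp add: LBINT_eq_restrict_space)
      moreover have "Y t \<omega> = Y 0 \<omega> - (LBINT s:{0..t}. ?H s) + I t \<omega>" using elim t by blast
      ultimately show "\<bar>I t \<omega>\<bar> \<le> \<bar>Y t \<omega>\<bar> + ?q \<omega>" by linarith
    qed
  qed
qed

text \<open>The hypothesis of Fubini's theorem in \<open>integral_K\<close>. Since
  \<open>\<beta>\<close> is bounded by \<open>C\<close>, the bound on \<open>I\<close> dominates
  \<open>K s\<close> by \<open>C\<close> times the sum of the moduli of \<open>Y T\<close> and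
  \<open>Y s\<close> and twice \<open>q\<close>.\<close>

lemma integrable_K: "integrable (\<Lambda> \<Otimes>\<^sub>M M) (\<lambda>(s, \<omega>). K s \<omega>)"
proof -
  obtain C where C: "0 \<le> C" and ae1: "AE \<omega> in M. set_integrable lborel {0..T} (\<lambda>s. \<beta> s \<omega>) \<and>
    (\<forall>t\<in>{0..T}. X t \<omega> - Xa t \<omega> = (LBINT s:{0..t}. \<beta> s \<omega>)) \<and> (\<forall>s\<in>{0..T}. \<bar>\<beta> s \<omega>\<bar> \<le> C)"
    by (rule state_difference)
  obtain q where q: "integrable M q" and ae2: "AE \<omega> in M. \<forall>s\<in>{0..T}. \<bar>I s \<omega>\<bar> \<le> \<bar>Y s \<omega>\<bar> + q \<omega>"
    by (rule integral_bound)
  have "AE \<omega> in M. \<forall>s\<in>{0..T}. \<bar>K s \<omega>\<bar> \<le> C * (\<bar>Y T \<omega>\<bar> + q \<omega> + (\<bar>Y s \<omega>\<bar> + q \<omega>))"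
    using ae1 ae2
  proof eventually_elim
    case (elim \<omega>)
    show ?case
    proof
      fix s assume s: "s \<in> {0..T}"
      have "\<bar>I T \<omega> - I s \<omega>\<bar> \<le> \<bar>Y T \<omega>\<bar> + q \<omega> + (\<bar>Y s \<omega>\<bar> + q \<omega>)"
        using bspec[OF elim(2) T_in(1)] bspec[OF elim(2) s] by linarith
      moreover have "\<bar>\<beta> s \<omega>\<bar> \<le> C" using elim s by blast
      ultimately show "\<bar>K s \<omega>\<bar> \<le> C * (\<bar>Y T \<omega>\<bar> + q \<omega> + (\<bar>Y s \<omega>\<bar> + q \<omega>))"
        unfolding K_def abs_mult using C by (intro mult_mono) auto
    qed
  qed
  from AE_pair_snd[OF this]
  have bound: "AE p in \<Lambda> \<Otimes>\<^sub>M M. norm (case p of (s, \<omega>) \<Rightarrow> K s \<omega>) \<le>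
      norm (C * ((\<lambda>(s, \<omega>). \<bar>Y T \<omega>\<bar> + q \<omega> + q \<omega>) p + \<bar>(\<lambda>(s, \<omega>). Y s \<omega>) p\<bar>))"
    using AE_space
  proof eventually_elim
    case (elim p)
    then show ?case
      by (cases p) (force simp: space_pair_measure algebra_simps)
  qed
  have "integrable M (\<lambda>\<omega>. \<bar>Y T \<omega>\<bar> + q \<omega> + q \<omega>)"
    using q integrable_Y_at[OF T_in(1)] by (intro Bochner_Integration.integrable_add integrable_abs)
  from integrable_joint_snd[OF this] have
    G: "integrable (\<Lambda> \<Otimes>\<^sub>M M) (\<lambda>p. C * ((\<lambda>(s, \<omega>). \<bar>Y T \<omega>\<bar> + q \<omega> + q \<omega>) p + \<bar>(\<lambda>(s, \<omega>). Y s \<omega>) p\<bar>))"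
    using integrable_Y_joint by (intro integrable_mult_right Bochner_Integration.integrable_add integrable_abs)
  have "(\<lambda>p. I T (snd p)) \<in> borel_measurable (\<Lambda> \<Otimes>\<^sub>M M)"
    by (rule measurable_compose[OF measurable_snd measurable_at[OF progressive_I T_in(1)]])
  then have "(\<lambda>(s, \<omega>). K s \<omega>) \<in> borel_measurable (\<Lambda> \<Otimes>\<^sub>M M)"
    using joint_measurable[OF progressive_\<beta>] joint_measurable[OF progressive_I]
    unfolding K_def case_prod_beta' by (intro borel_measurable_times borel_measurable_diff)
  then show ?thesis
    by (rule Bochner_Integration.integrable_bound[OF G _ bound])
qed

lemma integral_K: "(\<integral>\<omega>. (\<integral>s. K s \<omega> \<partial>\<Lambda>) \<partial>M) = 0"
proof -
  obtain C where C: "0 \<le> C" and ae: "AE \<omega> in M. set_integrable lborel {0..T} (\<lambda>s. \<beta> s \<omega>) \<and>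
    (\<forall>t\<in>{0..T}. X t \<omega> - Xa t \<omega> = (LBINT s:{0..t}. \<beta> s \<omega>)) \<and> (\<forall>s\<in>{0..T}. \<bar>\<beta> s \<omega>\<bar> \<le> C)"
    by (rule state_difference)
  have "(\<integral>\<omega>. K s \<omega> \<partial>M) = 0" if s: "s \<in> {0..T}" for s
    unfolding K_def
  proof (rule ito_integral_orthogonal(2)[OF W I s progressive_adapted[OF progressive_\<beta> s]])
    show "integrable M (\<lambda>\<omega>. (\<beta> s \<omega>)\<^sup>2)"
    proof (rule integrable_const_bound[of _ "C\<^sup>2"])
      show "AE \<omega> in M. norm ((\<beta> s \<omega>)\<^sup>2) \<le> C\<^sup>2"
        using ae
      proof eventually_elim
        case (elim \<omega>)
        then have "\<bar>\<beta> s \<omega>\<bar> \<le> C" using s by blast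
        then have "\<bar>\<beta> s \<omega>\<bar>\<^sup>2 \<le> C\<^sup>2" by (intro power_mono) auto
        then show ?case by simp
      qed
      show "(\<lambda>\<omega>. (\<beta> s \<omega>)\<^sup>2) \<in> borel_measurable M"
        by (intro borel_measurable_power measurable_at[OF progressive_\<beta> s])
    qed
  qed
  then have "(\<integral>s. (\<integral>\<omega>. K s \<omega> \<partial>M) \<partial>\<Lambda>) = (\<integral>s. 0 \<partial>\<Lambda>)"
    by (intro Bochner_Integration.integral_cong) auto
  then show ?thesis
    using Fubini_integral[OF integrable_K] by simp
qed

text \<open>Integration by parts of \<open>Y * (X - Xa)\<close> along one path; \<open>K\<close> carries the martingale part.\<close>
lemma pathwise_duality:
  assumes \<beta>: "set_integrable lborel {0..T} (\<lambda>s. \<beta> s \<omega>)"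
    and D: "\<And>t. t \<in> {0..T} \<Longrightarrow> X t \<omega> - Xa t \<omega> = (LBINT s:{0..t}. \<beta> s \<omega>)"
    and h: "set_integrable lborel {0..T} (\<lambda>s. h s \<omega>)"
    and Y: "\<And>t. t \<in> {0..T} \<Longrightarrow> Y t \<omega> = Y 0 \<omega> - (LBINT s:{0..t}. h s \<omega>) + I t \<omega>"
    and K: "set_integrable lborel {0..T} (\<lambda>s. K s \<omega>)"
  shows "set_integrable lborel {0..T} (\<lambda>s. \<beta> s \<omega> * Y s \<omega> - (X s \<omega> - Xa s \<omega>) * h s \<omega>)"
    and "(LBINT s:{0..T}. \<beta> s \<omega> * Y s \<omega> - (X s \<omega> - Xa s \<omega>) * h s \<omega>) =
      Y T \<omega> * (X T \<omega> - Xa T \<omega>) - (LBINT s:{0..T}. K s \<omega>)"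
proof -
  let ?D = "\<lambda>s. X s \<omega> - Xa s \<omega>"
  note parts = integral_by_parts_Fubini[OF \<beta> h]
  have Dh: "set_integrable lborel {0..T} (\<lambda>s. ?D s * h s \<omega>)"
    by (rule iffD2[OF set_integrable_cong[OF refl refl] parts(2)]) (simp add: D)
  have Deq: "(LBINT s:{0..T}. ?D s * h s \<omega>) = (LBINT r:{0..T}. (LBINT s:{0..r}. \<beta> s \<omega>) * h r \<omega>)"
    by (rule set_lebesgue_integral_cong) (use D in auto)
  \<comment> \<open>\<open>Y s\<close> is expanded backward from its terminal value. Both
    \<open>Y T\<close> and the integral of \<open>h\<close> over \<open>{s..T}\<close> look into the
    future, which is harmless along a fixed path, where \<open>Y T\<close> is a constant.\<close>
  have \<beta>Y: "\<beta> s \<omega> * Y s \<omega> = Y T \<omega> * \<beta> s \<omega> + \<beta> s \<omega> * (LBINT r:{s..T}. h r \<omega>) - K s \<omega>"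
    if s: "s \<in> {0..T}" for s
  proof -
    have I: "I T \<omega> - I s \<omega> = Y T \<omega> - Y s \<omega> + (LBINT r:{s..T}. h r \<omega>)"
      using Y[OF s] Y[OF T_in(1)] set_integral_Icc_diff[OF h s] by linarith
    show ?thesis unfolding K_def I by (simp add: algebra_simps)
  qed
  have YT: "set_integrable lborel {0..T} (\<lambda>s. Y T \<omega> * \<beta> s \<omega>)"
    using \<beta> by (rule set_integrable_mult_right)
  have sum: "set_integrable lborel {0..T} (\<lambda>s. Y T \<omega> * \<beta> s \<omega> + \<beta> s \<omega> * (LBINT r:{s..T}. h r \<omega>))"
    using YT parts(1) by (rule set_integral_add)
  have diff: "set_integrable lborel {0..T} (\<lambda>s. Y T \<omega> * \<beta> s \<omega> + \<beta> s \<omega> * (LBINT r:{s..T}. h r \<omega>) - K s \<omega>)"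
    using sum K by (rule set_integral_diff)
  have int: "set_integrable lborel {0..T} (\<lambda>s. \<beta> s \<omega> * Y s \<omega>)"
    by (rule iffD2[OF set_integrable_cong[OF refl refl \<beta>Y] diff])
  show "set_integrable lborel {0..T} (\<lambda>s. \<beta> s \<omega> * Y s \<omega> - ?D s * h s \<omega>)"
    using int Dh by (rule set_integral_diff)
  have "(LBINT s:{0..T}. \<beta> s \<omega> * Y s \<omega>) =
      (LBINT s:{0..T}. Y T \<omega> * \<beta> s \<omega> + \<beta> s \<omega> * (LBINT r:{s..T}. h r \<omega>) - K s \<omega>)"
    by (rule set_lebesgue_integral_cong) (use \<beta>Y in auto)
  also have "\<dots> = Y T \<omega> * (LBINT s:{0..T}. \<beta> s \<omega>) + (LBINT s:{0..T}. \<beta> s \<omega> * (LBINT r:{s..T}. h r \<omega>))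
      - (LBINT s:{0..T}. K s \<omega>)"
    by (simp add: set_integral_diff(2)[OF sum K] set_integral_add(2)[OF YT parts(1)])
  \<comment> \<open>The triangle identity makes the middle term the integral of
    \<open>?D * h\<close>, which the subtraction in the conclusion removes.\<close>
  also have "\<dots> = Y T \<omega> * ?D T + (LBINT s:{0..T}. ?D s * h s \<omega>) - (LBINT s:{0..T}. K s \<omega>)"
    by (simp only: D[OF T_in(1)] parts(3) Deq)
  finally show "(LBINT s:{0..T}. \<beta> s \<omega> * Y s \<omega> - ?D s * h s \<omega>) =
      Y T \<omega> * ?D T - (LBINT s:{0..T}. K s \<omega>)"
    by (simp add: set_integral_diff(2)[OF int Dh])
qed

text \<open>The \<open>b1\<close> terms of \<open>\<beta> * Y\<close> and of
  \<open>(X - Xa) * h\<close> cancel. What remains are the linear terms of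
  \<open>running_cost_growth\<close> with base point \<open>(X, ahat)\<close>.\<close>

lemma running_cost_comparison:
  assumes s: "s \<in> {0..T}" and \<omega>: "\<omega> \<in> space M"
  shows "\<beta> s \<omega> * Y s \<omega> - (X s \<omega> - Xa s \<omega>) * h s \<omega>
    \<le> f s (Xa s \<omega>) (\<mu> s) (a s \<omega>) - f s (X s \<omega>) (\<mu> s) (ahat s \<omega>) - lam * \<bar>a s \<omega> - ahat s \<omega>\<bar>\<^sup>2"
proof -
  have "hamiltonian b f s (X s \<omega>) (\<mu> s) (Y s \<omega>) (ahat s \<omega>) \<le> hamiltonian b f s (X s \<omega>) (\<mu> s) (Y s \<omega>) u"
    if "u \<in> A" for u
    using hamiltonian_minimizer(2)[OF s flow_P2[OF s] that] by (simp add: ahat)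
  from running_cost_growth[OF s flow_P2[OF s] ahat_in[OF s] this a_in[OF s \<omega>], of "Xa s \<omega>"]
  show ?thesis
    by (simp add: \<beta>_def h_def algebra_simps)
qed

lemma cost_comparison:
  "cost M T f g \<mu> X ahat + lam * (LINT \<omega>|M. (LBINT t:{0..T}. \<bar>a t \<omega> - ahat t \<omega>\<bar>\<^sup>2))
     \<le> cost M T f g \<mu> Xa a"
proof -
  let ?F1 = "\<lambda>s \<omega>. f s (Xa s \<omega>) (\<mu> s) (a s \<omega>)" and ?F2 = "\<lambda>s \<omega>. f s (X s \<omega>) (\<mu> s) (ahat s \<omega>)"
    and ?F3 = "\<lambda>s \<omega>. \<bar>a s \<omega> - ahat s \<omega>\<bar>\<^sup>2"
  obtain R where R: "\<And>x. x \<in> A \<Longrightarrow> \<bar>x\<bar> \<le> R"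
    using compact_imp_bounded[OF A(1)] by (auto simp: bounded_iff)
  have F1: "integrable (\<Lambda> \<Otimes>\<^sub>M M) (\<lambda>(s, \<omega>). ?F1 s \<omega>)"
    by (rule integrable_joint_bounded[OF progressive_coeff[OF f_meas progressive_Xa progressive_a a_in], of Cf])
      (use f_bound[OF _ flow_P2 a_in] in auto)
  have F2: "integrable (\<Lambda> \<Otimes>\<^sub>M M) (\<lambda>(s, \<omega>). ?F2 s \<omega>)"
    by (rule integrable_joint_bounded[OF progressive_coeff[OF f_meas progressive_X progressive_ahat ahat_in], of Cf])
      (use f_bound[OF _ flow_P2 ahat_in] in auto)
  have F3: "integrable (\<Lambda> \<Otimes>\<^sub>M M) (\<lambda>(s, \<omega>). ?F3 s \<omega>)"
  proof (rule integrable_joint_bounded)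
    have "progressive M T W (\<lambda>s \<omega>. (a s \<omega> - ahat s \<omega>) * (a s \<omega> - ahat s \<omega>))"
      by (intro progressive_mult progressive_diff progressive_a progressive_ahat)
    then show "progressive M T W ?F3" by (simp add: power2_eq_square)
    fix s \<omega> assume s: "s \<in> {0..T}" and \<omega>: "\<omega> \<in> space M"
    have "\<bar>a s \<omega> - ahat s \<omega>\<bar> \<le> 2 * R"
      using R[OF ahat_in[OF s, of \<omega>]] R[OF a_in[OF s \<omega>]] by linarith
    then have "?F3 s \<omega> \<le> (2 * R)\<^sup>2" by (intro power_mono) auto
    then show "\<bar>?F3 s \<omega>\<bar> \<le> (2 * R)\<^sup>2" by simp
  qed
  have gi: "integrable M (\<lambda>\<omega>. g (V T \<omega>) (\<mu> T))" if V: "progressive M T W V" for V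
  proof (rule integrable_const_bound[of _ Cg])
    show "AE \<omega> in M. norm (g (V T \<omega>) (\<mu> T)) \<le> Cg"
      using g_bound[OF flow_P2[OF T_in(1)]] by simp
    have "(\<lambda>(x, \<nu>). g x \<nu>) \<in> borel_measurable (borel \<Otimes>\<^sub>M P2_algebra)"
      using g unfolding terminal_cost_assumption_def by blast
    moreover have "(\<lambda>\<omega>. (V T \<omega>, \<mu> T)) \<in> M \<rightarrow>\<^sub>M borel \<Otimes>\<^sub>M P2_algebra"
      using measurable_at[OF V T_in(1)] flow_P2[OF T_in(1)]
      by (intro measurable_Pair measurable_const) auto
    ultimately show "(\<lambda>\<omega>. g (V T \<omega>) (\<mu> T)) \<in> borel_measurable M"
      using measurable_compose by fastforce
  qed
  note i = integrable_snd[OF F1] integrable_snd[OF F2] integrable_snd[OF F3] integrable_snd[OF integrable_K]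
    gi[OF progressive_X] gi[OF progressive_Xa]
  obtain C where ae: "AE \<omega> in M. set_integrable lborel {0..T} (\<lambda>s. \<beta> s \<omega>) \<and>
    (\<forall>t\<in>{0..T}. X t \<omega> - Xa t \<omega> = (LBINT s:{0..t}. \<beta> s \<omega>)) \<and> (\<forall>s\<in>{0..T}. \<bar>\<beta> s \<omega>\<bar> \<le> C)"
    by (rule state_difference)
  \<comment> \<open>The integral of \<open>K\<close> has no sign along a single path, so it is
    carried through this inequality and disappears on taking expectations.\<close>
  have "AE \<omega> in M. ((\<integral>s. ?F2 s \<omega> \<partial>\<Lambda>) + g (X T \<omega>) (\<mu> T)) + lam * (\<integral>s. ?F3 s \<omega> \<partial>\<Lambda>) - (\<integral>s. K s \<omega> \<partial>\<Lambda>)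
      \<le> (\<integral>s. ?F1 s \<omega> \<partial>\<Lambda>) + g (Xa T \<omega>) (\<mu> T)"
    using AE_space ae backward AE_integrable_snd[OF F1] AE_integrable_snd[OF F2] AE_integrable_snd[OF F3]
      AE_integrable_snd[OF integrable_K]
  proof eventually_elim
    case (elim \<omega>)
    let ?H = "\<lambda>s. hamiltonian_x b f s (X s \<omega>) (\<mu> s) (Y s \<omega>) (ahat s \<omega>)"
    have H: "set_integrable lborel {0..T} ?H" using elim(3) by blast
    have hint: "set_integrable lborel {0..T} (\<lambda>s. h s \<omega>)"
      by (rule iffD1[OF set_integrable_cong[OF refl refl h_eq] H])
    have Yeq: "Y t \<omega> = Y 0 \<omega> - (LBINT s:{0..t}. h s \<omega>) + I t \<omega>" if t: "t \<in> {0..T}" for t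
    proof -
      have "(LBINT s:{0..t}. ?H s) = (LBINT s:{0..t}. h s \<omega>)"
        using h_eq t by (intro set_lebesgue_integral_cong) auto
      then show ?thesis using elim(3) t by fastforce
    qed
    have K: "set_integrable lborel {0..T} (\<lambda>s. K s \<omega>)"
      using elim(7) by (simp only: set_integrable_iff_restrict_space)
    have \<beta>: "set_integrable lborel {0..T} (\<lambda>s. \<beta> s \<omega>)"
      and D: "\<And>t. t \<in> {0..T} \<Longrightarrow> X t \<omega> - Xa t \<omega> = (LBINT s:{0..t}. \<beta> s \<omega>)"
      using elim(2) by blast+
    note dual = pathwise_duality[OF \<beta> D hint Yeq K, unfolded set_integrable_iff_restrict_space LBINT_eq_restrict_space]
    have "Y T \<omega> * (X T \<omega> - Xa T \<omega>) - (\<integral>s. K s \<omega> \<partial>\<Lambda>)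
        = (\<integral>s. \<beta> s \<omega> * Y s \<omega> - (X s \<omega> - Xa s \<omega>) * h s \<omega> \<partial>\<Lambda>)"
      using dual(2) by simp
    also have "\<dots> \<le> (\<integral>s. ?F1 s \<omega> - ?F2 s \<omega> - lam * ?F3 s \<omega> \<partial>\<Lambda>)"
      by (rule integral_mono[OF dual(1)])
        (use elim(4-6) running_cost_comparison[OF _ elim(1)] in auto)
    also have "\<dots> = (\<integral>s. ?F1 s \<omega> \<partial>\<Lambda>) - (\<integral>s. ?F2 s \<omega> \<partial>\<Lambda>) - lam * (\<integral>s. ?F3 s \<omega> \<partial>\<Lambda>)"
      using elim(4-6) by simp
    finally have "Y T \<omega> * (X T \<omega> - Xa T \<omega>) - (\<integral>s. K s \<omega> \<partial>\<Lambda>)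
      \<le> (\<integral>s. ?F1 s \<omega> \<partial>\<Lambda>) - (\<integral>s. ?F2 s \<omega> \<partial>\<Lambda>) - lam * (\<integral>s. ?F3 s \<omega> \<partial>\<Lambda>)" .
    \<comment> \<open>The terminal condition makes \<open>Y T\<close> the slope of \<open>g\<close>
      at \<open>X T\<close>, so the tangent inequality cancels the boundary term left by the
      duality.\<close>
    moreover have "Y T \<omega> * (Xa T \<omega> - X T \<omega>) \<le> g (Xa T \<omega>) (\<mu> T) - g (X T \<omega>) (\<mu> T)"
      using terminal_cost_tangent[OF flow_P2[OF T_in(1)], of "X T \<omega>" "Xa T \<omega>"] elim(3) by simp
    ultimately show ?case
      by (simp add: right_diff_distrib)
  qed
  then have "(\<integral>\<omega>. ((\<integral>s. ?F2 s \<omega> \<partial>\<Lambda>) + g (X T \<omega>) (\<mu> T)) + lam * (\<integral>s. ?F3 s \<omega> \<partial>\<Lambda>) - (\<integral>s. K s \<omega> \<partial>\<Lambda>) \<partial>M)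
      \<le> (\<integral>\<omega>. (\<integral>s. ?F1 s \<omega> \<partial>\<Lambda>) + g (Xa T \<omega>) (\<mu> T) \<partial>M)"
    using i by (intro integral_mono_AE) auto
  then show ?thesis
    using i integral_K unfolding cost_def LBINT_eq_restrict_space by simp
qed

end

theorem theorem3p3p2:
  fixes M :: "'a measure" and W :: "real \<Rightarrow> 'a \<Rightarrow> real" and T \<sigma> lam :: real
    and x0 :: "'a \<Rightarrow> real" and A :: "real set" and \<mu> :: "real \<Rightarrow> real measure"
    and b f :: coeff and g :: "real \<Rightarrow> real measure \<Rightarrow> real"
    and X Y Z ahat :: "real \<Rightarrow> 'a \<Rightarrow> real"
  assumes "T > 0"
    and "brownian_motion M T W"
    and "x0 \<in> borel_measurable (augmented_filtration M W 0)"
    and "integrable M (\<lambda>\<omega>. (x0 \<omega>)\<^sup>2)"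
    and "compact A" and "convex A"
    and "drift_assumption T A b"
    and "lam > 0" and "running_cost_assumption T A lam f"
    and "terminal_cost_assumption g"
    and "bounded_flow T \<mu>"
    and "fbsde_solution M T W \<sigma> x0 A b f g \<mu> X Y Z"
    and "(\<integral>\<^sup>+\<omega>. ((SUP t\<in>{0..T}. ennreal (\<bar>X t \<omega>\<bar>\<^sup>2 + \<bar>Y t \<omega>\<bar>\<^sup>2))
              + (\<integral>\<^sup>+t\<in>{0..T}. ennreal (\<bar>Z t \<omega>\<bar>\<^sup>2) \<partial>lborel)) \<partial>M) < \<infinity>"
    and "\<And>t \<omega>. ahat t \<omega> = hamiltonian_minimizer A b f t (X t \<omega>) (\<mu> t) (Y t \<omega>)"
  shows "\<forall>a Xa. admissible M T W A a \<longrightarrow> state_process M T W \<sigma> x0 b \<mu> a Xa \<longrightarrow>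
           cost M T f g \<mu> X ahat + lam * (LINT \<omega>|M. (LBINT t:{0..T}. \<bar>a t \<omega> - ahat t \<omega>\<bar>\<^sup>2))
             \<le> cost M T f g \<mu> Xa a"
proof (intro allI impI)
  fix a Xa assume a: "admissible M T W A a" and Xa: "state_process M T W \<sigma> x0 b \<mu> a Xa"
  have opt: "optimal_feedback A b f \<mu> X Y = ahat"
    by (simp add: optimal_feedback_def[abs_def] assms(14)[abs_def])
  interpret prob_space M using assms(2) by (simp add: brownian_motion_def)
  obtain b0 b1 b2 B1 B2 where
    b_eq: "\<forall>t\<in>{0..T}. \<forall>x. \<forall>\<mu>\<in>P2. \<forall>a\<in>A. b t x \<mu> a = b0 t \<mu> + b1 t * x + b2 t * a"
    and b12: "b1 \<in> borel_measurable (restrict_space borel {0..T})" "\<forall>t\<in>{0..T}. \<bar>b1 t\<bar> \<le> B1"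
      "b2 \<in> borel_measurable (restrict_space borel {0..T})" "\<forall>t\<in>{0..T}. \<bar>b2 t\<bar> \<le> B2"
    using assms(7) unfolding drift_assumption_def by blast
  obtain Cf where Cf: "\<forall>t\<in>{0..T}. \<forall>x. \<forall>\<mu>\<in>P2. \<forall>a\<in>A.
      \<bar>f t x \<mu> a\<bar> \<le> Cf \<and> \<bar>partial_x f t x \<mu> a\<bar> \<le> Cf \<and> \<bar>partial_a A f t x \<mu> a\<bar> \<le> Cf"
    using assms(9) unfolding running_cost_assumption_def by blast
  obtain Cg where Cg: "\<forall>x. \<forall>\<mu>\<in>P2. \<bar>g x \<mu>\<bar> \<le> Cg"
    using assms(10) unfolding terminal_cost_assumption_def by blast
  \<comment> \<open>The control itself excludes an empty \<open>A\<close>: a probability space has a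
    scenario, and the value of the control there lies in \<open>A\<close>.\<close>
  obtain \<omega>0 where "\<omega>0 \<in> space M" using not_empty by auto
  then have "a 0 \<omega>0 \<in> A" using a assms(1) by (simp add: admissible_def)
  then have "A \<noteq> {}" by auto
  interpret control_problem T lam A b f g \<mu> b0 b1 b2 B1 B2 Cf Cg
  proof (unfold_locales)
    show "measurable_coeff T A b"
      using assms(7) unfolding drift_assumption_def by blast
  qed (use assms(1,5,6,8-11) b_eq b12 Cf Cg \<open>A \<noteq> {}\<close> in blast)+
  have fb: "fbsde_solution M T W \<sigma> x0 A b f g \<mu> X Y Z" by (fact assms(12))
  obtain I where I: "ito_integral M T W Z I" and backward: "AE \<omega> in M.
          set_integrable lborel {0..T} (\<lambda>s. hamiltonian_x b f s (X s \<omega>) (\<mu> s) (Y s \<omega>) (ahat s \<omega>)) \<and>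
          (\<forall>t\<in>{0..T}. Y t \<omega> = Y 0 \<omega>
            - (LBINT s:{0..t}. hamiltonian_x b f s (X s \<omega>) (\<mu> s) (Y s \<omega>) (ahat s \<omega>)) + I t \<omega>) \<and>
          Y T \<omega> = deriv (\<lambda>x. g x (\<mu> T)) (X T \<omega>)"
    using fb unfolding fbsde_solution_def opt by blast
  have "state_process M T W \<sigma> x0 b \<mu> ahat X" "continuous_progressive M T W Y"
    using fb unfolding fbsde_solution_def opt by blast+
  \<comment> \<open>The supremum runs over uncountably many times; monotonicity of the nonnegative
    integral holds for arbitrary functions, so its measurability is not an issue.\<close>
  moreover have "(\<integral>\<^sup>+\<omega>. ennreal ((Y t \<omega>)\<^sup>2) \<partial>M) \<le>
      (\<integral>\<^sup>+\<omega>. ((SUP t\<in>{0..T}. ennreal (\<bar>X t \<omega>\<bar>\<^sup>2 + \<bar>Y t \<omega>\<bar>\<^sup>2))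
              + (\<integral>\<^sup>+t\<in>{0..T}. ennreal (\<bar>Z t \<omega>\<bar>\<^sup>2) \<partial>lborel)) \<partial>M)" if t: "t \<in> {0..T}" for t
  proof (rule nn_integral_mono)
    fix \<omega>
    have "ennreal ((Y t \<omega>)\<^sup>2) \<le> ennreal (\<bar>X t \<omega>\<bar>\<^sup>2 + \<bar>Y t \<omega>\<bar>\<^sup>2)"
      by (rule ennreal_leI) simp
    also have "\<dots> \<le> (SUP t\<in>{0..T}. ennreal (\<bar>X t \<omega>\<bar>\<^sup>2 + \<bar>Y t \<omega>\<bar>\<^sup>2))"
      using t by (rule SUP_upper)
    finally show "ennreal ((Y t \<omega>)\<^sup>2) \<le> (SUP t\<in>{0..T}. ennreal (\<bar>X t \<omega>\<bar>\<^sup>2 + \<bar>Y t \<omega>\<bar>\<^sup>2))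
              + (\<integral>\<^sup>+t\<in>{0..T}. ennreal (\<bar>Z t \<omega>\<bar>\<^sup>2) \<partial>lborel)"
      by (rule add_increasing2[OF zero_le])
  qed
  ultimately interpret controlled_comparison T lam A b f g \<mu> b0 b1 b2 B1 B2 Cf Cg M W \<sigma> x0 X Y Z I ahat a Xa
    "\<integral>\<^sup>+\<omega>. ((SUP t\<in>{0..T}. ennreal (\<bar>X t \<omega>\<bar>\<^sup>2 + \<bar>Y t \<omega>\<bar>\<^sup>2))
              + (\<integral>\<^sup>+t\<in>{0..T}. ennreal (\<bar>Z t \<omega>\<bar>\<^sup>2) \<partial>lborel)) \<partial>M"
    using assms(2,13,14) I backward a Xa by unfold_locales
  show "cost M T f g \<mu> X ahat + lam * (LINT \<omega>|M. (LBINT t:{0..T}. \<bar>a t \<omega> - ahat t \<omega>\<bar>\<^sup>2))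
             \<le> cost M T f g \<mu> Xa a"
    by (rule cost_comparison)
qed

end
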